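(* Let $g\in W_0$ have stable integer shifts, and let $k\in\mathbb{N}$. (i) If $g$ is odd, then for every choice of points $0<x_1<\dots<x_{\lfloor k/2\rfloor}<\lfloor k/2\rfloor$, with $\Lambda_k=\left(F_{\lfloor k/2\rfloor}\cup\{0,\tfrac{k}{2}\}\right)+k\mathbb{Z}$, the Gabor system $\mathcal{G}(g,\Lambda_k\times\mathbb{Z})$ is not a frame for $L^2(\mathbb{R})$. (ii) Assume that $g$ is even. If $k$ is odd, then for every choice of points $0<x_1<\dots<x_{(k-1)/2}<(k-1)/2$, with $\Gamma_k=\left(F_{(k-1)/2}\cup\{\tfrac{k}{2}\}\right)+k\mathbb{Z}$, the system $\mathcal{G}(g,\Gamma_k\times\mathbb{Z})$ is not a frame for $L^2(\mathbb{R})$. If $k$ is even, then for every choice of points $0<x_1<\dots<x_{k/2}<k/2$, with $\Theta_k=F_{k/2}+k\mathbb{Z}$, the system $\mathcal{G}(g,\Theta_k\times\mathbb{Z})$ is not a frame for $L^2(\mathbb{R})$.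
   Context: $\mathbb{N}=\{1,2,\dots\}$; $\lfloor s\rfloor$ is the greatest integer $\le s$. For sets $A,B\subset\mathbb{R}$, $A+B=\{a+b:a\in A,b\in B\}$. For discrete sets $\Lambda,\Gamma\subset\mathbb{R}$, the Gabor system is $\mathcal{G}(g,\Lambda\times\Gamma)=\{g(x-\lambda)e^{2\pi i\gamma x}:\lambda\in\Lambda,\gamma\in\Gamma\}$; "frame" is meant in the usual Hilbert space sense. $W_0$ is the set of continuous functions $g:\mathbb{R}\to\mathbb{C}$ with $\sum_{m\in\mathbb{Z}}\|g\|_{L^\infty(m,m+1)}<\infty$. The function $g$ has stable integer shifts if for every $p\in[1,\infty]$ there are constants $A,B>0$ such that $A\|\{c_n\}\|_{\ell^p}\le\|\sum_n c_n g(\cdot-n)\|_{L^p(\mathbb{R})}\le B\|\{c_n\}\|_{\ell^p}$ for all $\{c_n\}\in\ell^p(\mathbb{Z})$. For $n\in\mathbb{N}$ and points $0<x_1<\dots<x_n<n$, $F_n=F_n(x_1,\dots,x_n)=\{\pm x_1,\dots,\pm x_n\}$; $F_0=\emptyset$. $g$ is odd if $g(-x)=-g(x)$ and even if $g(-x)=g(x)$ for all $x\in\mathbb{R}$. *)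

theory Defs
  imports "HOL-Analysis.Analysis" "HOL-Probability.Essential_Supremum"
begin

text \<open>
  The \<open>L\<^sup>p\<close> norm for \<open>1 \<le> p \<le> \<infinity>\<close> with values in \<open>[0, \<infinity>]\<close>.  With \<open>M = lborel\<close> it is the norm of
  \<open>L\<^sup>p(\<real>)\<close>, and with \<open>M = count_space UNIV\<close> the norm of \<open>\<ell>\<^sup>p\<close>.
\<close>

definition Lp_norm :: "ennreal \<Rightarrow> 'a measure \<Rightarrow> ('a \<Rightarrow> complex) \<Rightarrow> ennreal" where
  "Lp_norm p M f =
     (if p = \<infinity> then esssup M (\<lambda>x. ennreal (norm (f x)))
      else let I = (\<integral>\<^sup>+ x. ennreal (norm (f x) powr enn2real p) \<partial>M)
           in if I = \<infinity> then \<infinity> else ennreal (enn2real I powr (1 / enn2real p)))"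

definition Lp :: "ennreal \<Rightarrow> 'a measure \<Rightarrow> ('a \<Rightarrow> complex) set" where
  "Lp p M = {f \<in> borel_measurable M. Lp_norm p M f < \<infinity>}"

definition L2_inner :: "(real \<Rightarrow> complex) \<Rightarrow> (real \<Rightarrow> complex) \<Rightarrow> complex" where
  "L2_inner f h = (\<integral>x. f x * cnj (h x) \<partial>lborel)"

text \<open>The sum of coefficients is taken in \<open>[0, \<infinity>]\<close>, so it always exists.\<close>

definition L2_frame :: "'i set \<Rightarrow> ('i \<Rightarrow> real \<Rightarrow> complex) \<Rightarrow> bool" where
  "L2_frame I h \<longleftrightarrow>
     (\<forall>i\<in>I. h i \<in> Lp 2 lborel) \<and>
     (\<exists>A>0. \<exists>B>0. \<forall>f\<in>Lp 2 lborel.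
        ennreal A * (Lp_norm 2 lborel f)\<^sup>2 \<le> (\<Sum>\<^sub>\<infinity>i\<in>I. ennreal ((norm (L2_inner f (h i)))\<^sup>2)) \<and>
        (\<Sum>\<^sub>\<infinity>i\<in>I. ennreal ((norm (L2_inner f (h i)))\<^sup>2)) \<le> ennreal B * (Lp_norm 2 lborel f)\<^sup>2)"

text \<open>
  The Gabor system of \<open>g\<close> over \<open>\<Lambda> \<times> \<Gamma>\<close> is the family \<open>gabor g\<close> indexed by \<open>\<Lambda> \<times> \<Gamma>\<close>.  For nonzero
  \<open>g\<close> in \<open>L\<^sup>2(\<real>)\<close> distinct indices give distinct functions, so it makes no difference
  whether one regards it as a family or as a set.
\<close>

definition gabor :: "(real \<Rightarrow> complex) \<Rightarrow> real \<times> real \<Rightarrow> real \<Rightarrow> complex" where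
  "gabor g = (\<lambda>(l, \<gamma>) x. g (x - l) * exp (2 * complex_of_real pi * \<i> * complex_of_real (\<gamma> * x)))"

definition W0 :: "(real \<Rightarrow> complex) set" where
  "W0 = {g. continuous_on UNIV g \<and>
     (\<Sum>\<^sub>\<infinity>m::int. Lp_norm \<infinity> (restrict_space lborel {real_of_int m<..<real_of_int m + 1}) g) < \<infinity>}"

text \<open>
  For \<open>g \<in> W0\<close> and a bounded sequence \<open>c\<close>, in particular for \<open>c \<in> \<ell>\<^sup>p\<close>, the sum of the shifts
  converges absolutely at every point; it is taken pointwise, which also covers \<open>p = \<infinity>\<close>.
\<close>

definition stable_integer_shifts :: "(real \<Rightarrow> complex) \<Rightarrow> bool" where
  "stable_integer_shifts g \<longleftrightarrow>
     (\<forall>p\<ge>1. \<exists>A>0. \<exists>B>0. \<forall>c \<in> Lp p (count_space (UNIV :: int set)).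
        ennreal A * Lp_norm p (count_space UNIV) c
          \<le> Lp_norm p lborel (\<lambda>x. \<Sum>\<^sub>\<infinity>n. c n * g (x - real_of_int n)) \<and>
        Lp_norm p lborel (\<lambda>x. \<Sum>\<^sub>\<infinity>n. c n * g (x - real_of_int n))
          \<le> ennreal B * Lp_norm p (count_space UNIV) c)"

text \<open>
  Points \<open>0 < x\<^sub>1 < \<dots> < x\<^sub>n < n\<close>, given by the values of \<open>x\<close> on \<open>{1..n}\<close>; for \<open>n = 0\<close>
  there are no points and the condition is void.
\<close>

definition increasing_points :: "nat \<Rightarrow> (nat \<Rightarrow> real) \<Rightarrow> bool" where
  "increasing_points n x \<longleftrightarrow>
     strict_mono_on {1..n} x \<and> (\<forall>j\<in>{1..n}. 0 < x j \<and> x j < real n)"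

definition F_pts :: "nat \<Rightarrow> (nat \<Rightarrow> real) \<Rightarrow> real set" where
  "F_pts n x = x ` {1..n} \<union> (\<lambda>j. - x j) ` {1..n}"

definition multiples :: "nat \<Rightarrow> real set" where
  "multiples k = (\<lambda>m. real k * real_of_int m) ` UNIV"

end

theory Submission
  imports Defs
begin

text \<open>
  For a bounded sequence \<open>c\<close> on \<open>\<int>\<close> put \<open>f t = (\<Sum>n. c n * g (t - n))\<close>.  The idea is that a nonzero \<open>c\<close>,
  periodic up to sign, whose \<open>f\<close> vanishes at every point \<open>- l\<close> of the reflected lattice excludes the lower frame bound,
  and that the symmetry of \<open>g\<close> produces such a \<open>c\<close>.

  \<^emph>\<open>From zeros to failure of the frame bound\<close> (\<open>not_frame_if_zeros\<close>).  Testing the frame inequality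
  with a comb of short bumps of width \<open>\<delta>\<close> at the integers in \<open>[-N, N]\<close>, with heights taken from \<open>c\<close>,
  and applying Bessel's inequality in the frequency variable yields
  \<open>A * (\<Sum>\<bar>n\<bar>\<le>N. \<bar>c n\<bar>\<^sup>2) \<le> sup\<^sub>x (\<Sum>l. \<bar>f\<^sub>N (x - l)\<bar>\<^sup>2)\<close> with \<open>x\<close> in \<open>[0, \<delta>)\<close>, where \<open>f\<^sub>N\<close> is built from the
  truncation of \<open>c\<close> to \<open>[-N, N]\<close> (\<open>frame_coefficient_bound\<close>).  Since \<open>g\<close> is dominated by an
  envelope that is summable over unit intervals, \<open>f\<^sub>N\<close> agrees with \<open>f\<close> well inside \<open>[-N, N]\<close> and
  with \<open>0\<close> well outside, up to an error whose total over the lattice is \<open>o(N)\<close>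
  (\<open>sum_cut_commutator_le\<close>).  Inside, \<open>f (x - l)\<close> is small, by continuity
  and the periodicity of \<open>\<bar>f\<bar>\<close>.  For \<open>c\<close> periodic up to
  a unimodular factor the left-hand side grows linearly in \<open>N\<close>, a contradiction.

  \<^emph>\<open>Producing the zeros\<close> (\<open>not_frame_if_symmetric\<close>).  Let \<open>g (- t) = \<sigma> * g t\<close>, and let \<open>c\<close> be even with
  \<open>c (n + k) = s * c n\<close>, where \<open>\<sigma>\<close> and \<open>s\<close> are signs.  Then \<open>f (- t) = \<sigma> * f t\<close> and \<open>f (t + k) = s * f t\<close>,
  so \<open>f\<close> vanishes at \<open>0\<close> if \<open>\<sigma> = -1\<close> and at \<open>k / 2\<close> if \<open>s * \<sigma> = -1\<close>, and a zero at \<open>x\<^sub>j\<close> brings one at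
  \<open>- x\<^sub>j\<close>.  Such sequences are determined by their free values at \<open>0, \<dots>, m\<close>, where \<open>m\<close> is the number of
  points \<open>x\<^sub>j\<close>: there is one unknown more than there are equations \<open>f x\<^sub>j = 0\<close>, so a nonzero
  solution exists.  For odd \<open>g\<close> one takes \<open>s = 1\<close>; for even \<open>g\<close> one takes \<open>s = -1\<close> when \<open>k\<close> is odd and
  \<open>s = 1\<close> when \<open>k\<close> is even.
\<close>

section \<open>Underdetermined linear systems\<close>

text \<open>
  Gaussian elimination: an equation with a nonzero coefficient removes one unknown, its pivot, and itself.
\<close>

lemma underdetermined_system:
  fixes a :: "'j \<Rightarrow> 'i \<Rightarrow> 'a::field"
  assumes "finite J" "finite I" "card J < card I"
  shows "\<exists>d. (\<exists>i\<in>I. d i \<noteq> 0) \<and> (\<forall>j\<in>J. (\<Sum>i\<in>I. d i * a j i) = 0)"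
  using assms
proof (induction J arbitrary: I a rule: finite_induct)
  case empty
  then obtain i where "i \<in> I" by fastforce
  thus ?case by (intro exI[of _ "\<lambda>_. 1"]) auto
next
  case (insert j J)
  show ?case
  proof (cases "\<forall>i\<in>I. a j i = 0")
    case True
    have "card J < card I" using insert by simp
    from insert.IH[OF insert.prems(1) this, of a] True show ?thesis by auto
  next
    case False
    then obtain p where p: "p \<in> I" "a j p \<noteq> 0" by blast
    define I' where "I' = I - {p}"
    have "card J < card I'" "finite I'" using insert p by (auto simp: I'_def)
    then obtain d where d: "\<exists>i\<in>I'. d i \<noteq> 0"
      "\<forall>l\<in>J. (\<Sum>i\<in>I'. d i * (a l i - a l p * a j i / a j p)) = 0"
      using insert.IH[of I' "\<lambda>l i. a l i - a l p * a j i / a j p"] by blast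
    define e where "e = d(p := - (\<Sum>i\<in>I'. d i * a j i) / a j p)"
    have split: "(\<Sum>i\<in>I. e i * a l i) = (\<Sum>i\<in>I'. d i * a l i) - (\<Sum>i\<in>I'. d i * a j i) / a j p * a l p" for l
    proof -
      have "(\<Sum>i\<in>I. e i * a l i) = e p * a l p + (\<Sum>i\<in>I'. e i * a l i)"
        unfolding I'_def using insert.prems(1) p(1) by (rule sum.remove)
      also have "(\<Sum>i\<in>I'. e i * a l i) = (\<Sum>i\<in>I'. d i * a l i)"
        by (rule sum.cong) (auto simp: e_def I'_def)
      finally show ?thesis by (simp add: e_def)
    qed
    have "(\<Sum>i\<in>I. e i * a l i) = 0" if "l \<in> insert j J" for l
    proof (cases "l = j")
      case True
      thus ?thesis using p(2) by (simp add: split)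
    next
      case False
      hence "0 = (\<Sum>i\<in>I'. d i * (a l i - a l p * a j i / a j p))" using that d(2) by simp
      also have "\<dots> = (\<Sum>i\<in>I. e i * a l i)"
        by (simp add: split algebra_simps sum_subtractf sum_distrib_left sum_divide_distrib)
      finally show ?thesis by simp
    qed
    moreover have "\<exists>i\<in>I. e i \<noteq> 0" using d(1) by (auto simp: e_def I'_def)
    ultimately show ?thesis by blast
  qed
qed

section \<open>Sharp cut-offs against a summable kernel\<close>

definition cut :: "int \<Rightarrow> int \<Rightarrow> real" where
  "cut N n = of_bool (\<bar>n\<bar> \<le> N)"

lemma sum_le_card:
  fixes f :: "'a \<Rightarrow> real"
  assumes "finite P" "finite I" "\<And>p. p \<in> P \<Longrightarrow> f p \<le> of_bool (p \<in> I)"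
  shows "sum f P \<le> real (card I)"
proof -
  have "sum f P \<le> (\<Sum>p\<in>P. of_bool (p \<in> I))"
    by (rule sum_mono) (use assms(3) in auto)
  also have "\<dots> = real (card (P \<inter> I))"
    using assms(1) by (simp add: of_bool_def sum.If_cases)
  also have "\<dots> \<le> real (card I)"
    using assms(2) by (simp add: card_mono)
  finally show ?thesis .
qed

lemma sum_cut_le:
  assumes "finite P" "0 \<le> N"
  shows "(\<Sum>p\<in>P. cut N (p - m)) \<le> 2 * of_int N + 1"
proof -
  have "(\<Sum>p\<in>P. cut N (p - m)) \<le> real (card {m - N..m + N})"
    using assms(1) by (intro sum_le_card) (auto simp: cut_def)
  also have "\<dots> = 2 * of_int N + 1"
    using assms(2) by simp
  finally show ?thesis .
qed

text \<open>
  Passing from \<open>[-N, N]\<close> to its translate by \<open>m\<close> loses at most \<open>\<bar>m\<bar>\<close> integers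
  at one end and gains at most as many at the other; the bound does not grow with \<open>N\<close>.
\<close>

lemma sum_cut_diff_le:
  assumes "finite P" "0 \<le> N"
  shows "(\<Sum>p\<in>P. \<bar>cut N (p - m) - cut N p\<bar>) \<le> 2 * real_of_int \<bar>m\<bar>"
proof (cases "m \<ge> 0")
  case True
  have "(\<Sum>p\<in>P. \<bar>cut N (p - m) - cut N p\<bar>) \<le> real (card ({-N..<-N+m} \<union> {N<..N+m}))"
    using assms(1) True by (intro sum_le_card) (auto simp: cut_def of_bool_def abs_le_iff split: if_splits)
  also have "\<dots> \<le> real (card {-N..<-N+m} + card {N<..N+m})"
    using card_Un_le of_nat_mono by blast
  finally show ?thesis using True by simp
next
  case False
  have "(\<Sum>p\<in>P. \<bar>cut N (p - m) - cut N p\<bar>) \<le> real (card ({-N+m..<-N} \<union> {N+m<..N}))"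
    using assms(1) False by (intro sum_le_card) (auto simp: cut_def of_bool_def abs_le_iff split: if_splits)
  also have "\<dots> \<le> real (card {-N+m..<-N} + card {N+m<..N})"
    using card_Un_le of_nat_mono by blast
  finally show ?thesis using False by simp
qed

lemma has_sum_finite_sum:
  fixes f :: "'a \<Rightarrow> 'b \<Rightarrow> 'c::topological_comm_monoid_add"
  assumes "\<And>i. i \<in> I \<Longrightarrow> (f i has_sum S i) A"
  shows "((\<lambda>x. \<Sum>i\<in>I. f i x) has_sum (\<Sum>i\<in>I. S i)) A"
  using assms by (induction I rule: infinite_finite_induct) (auto intro: has_sum_add)

text \<open>
  The left-hand side bounds the commutator of convolution by \<open>\<gamma>\<close> with the cut-off to \<open>[-N, N]\<close>.  It is
  \<open>o(N)\<close>: the displacements \<open>m\<close> in a finite set \<open>B\<close> cost an amount independent of \<open>N\<close>, by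
  \<open>sum_cut_diff_le\<close>, while the others carry only the small mass of \<open>\<gamma>\<close> outside \<open>B\<close>.
\<close>

lemma sum_cut_commutator_le:
  fixes \<gamma> :: "int \<Rightarrow> real"
  assumes "finite P" "0 \<le> N" and \<gamma>: "\<And>m. 0 \<le> \<gamma> m" "\<gamma> summable_on UNIV"
    and B: "\<And>m. m \<in> B \<Longrightarrow> \<bar>m\<bar> \<le> K" and "0 \<le> K"
  shows "(\<Sum>p\<in>P. \<Sum>\<^sub>\<infinity>n. \<gamma> (p - n) * \<bar>cut N n - cut N p\<bar>)
      \<le> 2 * of_int K * infsum \<gamma> UNIV + (4 * of_int N + 2) * infsum \<gamma> (- B)"
proof -
  define D where "D m = (\<Sum>p\<in>P. \<bar>cut N (p - m) - cut N p\<bar>)" for m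
  have re: "(\<Sum>\<^sub>\<infinity>n. \<gamma> (p - n) * \<bar>cut N n - cut N p\<bar>) = (\<Sum>\<^sub>\<infinity>m. \<gamma> m * \<bar>cut N (p - m) - cut N p\<bar>)" for p
    by (rule infsum_reindex_bij_witness[of _ "\<lambda>n. p - n" "\<lambda>n. p - n"]) auto
  have sm: "(\<lambda>m. \<gamma> m * \<bar>cut N (p - m) - cut N p\<bar>) summable_on UNIV" for p
    by (rule summable_on_comparison_test[OF \<gamma>(2)]) (auto simp: \<gamma>(1) cut_def)
  have "((\<lambda>m. \<Sum>p\<in>P. \<gamma> m * \<bar>cut N (p - m) - cut N p\<bar>) has_sum
      (\<Sum>p\<in>P. \<Sum>\<^sub>\<infinity>m. \<gamma> m * \<bar>cut N (p - m) - cut N p\<bar>)) UNIV"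
    using sm by (intro has_sum_finite_sum) simp
  hence "((\<lambda>m. \<gamma> m * D m) has_sum (\<Sum>p\<in>P. \<Sum>\<^sub>\<infinity>m. \<gamma> m * \<bar>cut N (p - m) - cut N p\<bar>)) UNIV"
    unfolding D_def sum_distrib_left .
  moreover have "((\<lambda>m. \<gamma> m * (2 * of_int K) + \<gamma> m * of_bool (m \<in> - B) * (4 * of_int N + 2)) has_sum
      (infsum \<gamma> UNIV * (2 * of_int K) + infsum \<gamma> (- B) * (4 * of_int N + 2))) UNIV"
  proof (intro has_sum_add has_sum_cmult_left)
    show "(\<gamma> has_sum infsum \<gamma> UNIV) UNIV" using \<gamma>(2) by simp
    have "(\<gamma> has_sum infsum \<gamma> (- B)) (- B)"
      by (rule has_sum_infsum, rule summable_on_subset_banach[OF \<gamma>(2)]) simp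
    thus "((\<lambda>m. \<gamma> m * of_bool (m \<in> - B)) has_sum infsum \<gamma> (- B)) UNIV"
      by (rule has_sum_cong_neutral[THEN iffD1, rotated -1]) auto
  qed
  moreover have "\<gamma> m * D m \<le> \<gamma> m * (2 * of_int K) + \<gamma> m * of_bool (m \<in> - B) * (4 * of_int N + 2)" for m
  proof (cases "m \<in> B")
    case True
    have "D m \<le> 2 * of_int \<bar>m\<bar>" unfolding D_def using assms(1,2) by (rule sum_cut_diff_le)
    also have "\<dots> \<le> 2 * of_int K" using B[OF True] by simp
    finally show ?thesis using True by (simp add: mult_left_mono \<gamma>)
  next
    case False
    have "D m \<le> (\<Sum>p\<in>P. cut N (p - m) + cut N (p - 0))"
      unfolding D_def by (rule sum_mono) (auto simp: cut_def)
    also have "\<dots> \<le> 4 * of_int N + 2"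
      using sum_cut_le[OF assms(1,2), of m] sum_cut_le[OF assms(1,2), of 0]
      by (simp add: sum.distrib)
    finally have "D m \<le> 2 * of_int K + (4 * of_int N + 2)" using \<open>0 \<le> K\<close> by simp
    from mult_left_mono[OF this \<gamma>(1)] show ?thesis using False by (simp add: algebra_simps)
  qed
  ultimately have "(\<Sum>p\<in>P. \<Sum>\<^sub>\<infinity>m. \<gamma> m * \<bar>cut N (p - m) - cut N p\<bar>)
      \<le> infsum \<gamma> UNIV * (2 * of_int K) + infsum \<gamma> (- B) * (4 * of_int N + 2)"
    by (rule has_sum_mono) 
  thus ?thesis by (simp add: re mult_ac)
qed


section \<open>Bessel's inequality for integer frequencies\<close>

text \<open>
  Expand the integral of the square of the distance between \<open>u\<close> and its projection
  \<open>P = (\<Sum>i\<in>J. a i * e i)\<close>: by orthonormality, the integrals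
  of the cross terms and of \<open>\<bar>P\<bar>\<^sup>2\<close> all equal \<open>\<Sum>i\<in>J. \<bar>a i\<bar>\<^sup>2\<close>.
\<close>

lemma bessel_inequality:
  fixes u :: "'a \<Rightarrow> complex" and e :: "'i \<Rightarrow> 'a \<Rightarrow> complex"
  assumes "finite J"
    and uu: "integrable M (\<lambda>x. (norm (u x))\<^sup>2)"
    and ue: "\<And>i. i \<in> J \<Longrightarrow> integrable M (\<lambda>x. u x * cnj (e i x))"
    and ee: "\<And>i j. i \<in> J \<Longrightarrow> j \<in> J \<Longrightarrow> integrable M (\<lambda>x. e i x * cnj (e j x))"
    and orth: "\<And>i j. i \<in> J \<Longrightarrow> j \<in> J \<Longrightarrow> (\<integral>x. e i x * cnj (e j x) \<partial>M) = of_bool (i = j)"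
  shows "(\<Sum>i\<in>J. (norm (\<integral>x. u x * cnj (e i x) \<partial>M))\<^sup>2) \<le> (\<integral>x. (norm (u x))\<^sup>2 \<partial>M)"
proof -
  define a where "a i = (\<integral>x. u x * cnj (e i x) \<partial>M)" for i
  define P where "P x = (\<Sum>i\<in>J. a i * e i x)" for x
  \<comment> \<open>The expansion takes place in \<open>\<complex>\<close>; the real part returns to real integrals at the end.\<close>
  have nsq: "complex_of_real ((norm z)\<^sup>2) = z * cnj z" for z
    by (rule complex_norm_square)
  have uP: "has_bochner_integral M (\<lambda>x. u x * cnj (P x)) (\<Sum>i\<in>J. cnj (a i) * a i)"
  proof -
    have "has_bochner_integral M (\<lambda>x. \<Sum>i\<in>J. cnj (a i) * (u x * cnj (e i x))) (\<Sum>i\<in>J. cnj (a i) * a i)"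
      unfolding a_def using ue by (intro has_bochner_integral_sum has_bochner_integral_mult_right)
        (auto simp: has_bochner_integral_integrable)
    thus ?thesis by (simp add: P_def sum_distrib_left mult_ac)
  qed
  have PP: "has_bochner_integral M (\<lambda>x. P x * cnj (P x)) (\<Sum>i\<in>J. cnj (a i) * a i)"
  proof -
    have "has_bochner_integral M (\<lambda>x. \<Sum>i\<in>J. \<Sum>j\<in>J. (a i * cnj (a j)) * (e i x * cnj (e j x)))
       (\<Sum>i\<in>J. \<Sum>j\<in>J. (a i * cnj (a j)) * of_bool (i = j))"
      using ee orth by (intro has_bochner_integral_sum has_bochner_integral_mult_right) (auto simp: has_bochner_integral_iff)
    also have "(\<Sum>i\<in>J. \<Sum>j\<in>J. (a i * cnj (a j)) * of_bool (i = j)) = (\<Sum>i\<in>J. cnj (a i) * a i)"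
      using \<open>finite J\<close> by (simp add: mult.commute)
    also have "(\<lambda>x. \<Sum>i\<in>J. \<Sum>j\<in>J. (a i * cnj (a j)) * (e i x * cnj (e j x))) = (\<lambda>x. P x * cnj (P x))"
      by (simp add: P_def sum_product mult_ac)
    finally show ?thesis .
  qed
  have uu': "has_bochner_integral M (\<lambda>x. u x * cnj (u x)) (complex_of_real (\<integral>x. (norm (u x))\<^sup>2 \<partial>M))"
    using has_bochner_integral_of_real[OF has_bochner_integral_integrable[OF uu], where 'a = complex]
    by (simp only: nsq)
  have Pu: "has_bochner_integral M (\<lambda>x. cnj (u x) * P x) (\<Sum>i\<in>J. cnj (a i) * a i)"
    using has_bochner_integral_bounded_linear[OF bounded_linear_cnj uP] by (simp add: mult_ac)
  have "has_bochner_integral M (\<lambda>x. u x * cnj (u x) - u x * cnj (P x) - cnj (u x) * P x + P x * cnj (P x))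
     (complex_of_real (\<integral>x. (norm (u x))\<^sup>2 \<partial>M) - (\<Sum>i\<in>J. cnj (a i) * a i) - (\<Sum>i\<in>J. cnj (a i) * a i) + (\<Sum>i\<in>J. cnj (a i) * a i))"
    by (intro has_bochner_integral_add has_bochner_integral_diff uu' uP Pu PP)
  also have "(\<lambda>x. u x * cnj (u x) - u x * cnj (P x) - cnj (u x) * P x + P x * cnj (P x))
      = (\<lambda>x. complex_of_real ((norm (u x - P x))\<^sup>2))"
    by (simp only: nsq) (simp add: algebra_simps)
  also have "complex_of_real (\<integral>x. (norm (u x))\<^sup>2 \<partial>M) - (\<Sum>i\<in>J. cnj (a i) * a i) - (\<Sum>i\<in>J. cnj (a i) * a i) + (\<Sum>i\<in>J. cnj (a i) * a i)
      = complex_of_real ((\<integral>x. (norm (u x))\<^sup>2 \<partial>M) - (\<Sum>i\<in>J. (norm (a i))\<^sup>2))"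
    by (simp only: of_real_diff of_real_sum nsq) (simp add: mult.commute)
  finally have "has_bochner_integral M (\<lambda>x. Re (complex_of_real ((norm (u x - P x))\<^sup>2)))
      (Re (complex_of_real ((\<integral>x. (norm (u x))\<^sup>2 \<partial>M) - (\<Sum>i\<in>J. (norm (a i))\<^sup>2))))"
    by (rule has_bochner_integral_bounded_linear[OF bounded_linear_Re])
  hence "0 \<le> (\<integral>x. (norm (u x))\<^sup>2 \<partial>M) - (\<Sum>i\<in>J. (norm (a i))\<^sup>2)"
    unfolding Re_complex_of_real
    by (rule subst[OF has_bochner_integral_integral_eq]) (rule Bochner_Integration.integral_nonneg, simp)
  thus ?thesis by (simp add: a_def)
qed

definition harmonic :: "real \<Rightarrow> real \<Rightarrow> complex" where
  "harmonic \<gamma> x = exp (2 * complex_of_real pi * \<i> * complex_of_real (\<gamma> * x))"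

lemma norm_harmonic [simp]: "norm (harmonic \<gamma> x) = 1"
  by (simp add: harmonic_def)

lemma continuous_harmonic: "continuous_on S (harmonic \<gamma>)"
  unfolding harmonic_def by (intro continuous_intros)

lemma measurable_harmonic [measurable]: "harmonic \<gamma> \<in> borel_measurable borel"
  by (intro borel_measurable_continuous_onI continuous_harmonic)

lemma harmonic_mult_cnj: "harmonic \<alpha> x * cnj (harmonic \<beta> x) = harmonic (\<alpha> - \<beta>) x"
  by (simp add: harmonic_def exp_cnj exp_add[symmetric] algebra_simps)

lemma harmonic_add_int:
  assumes "\<gamma> \<in> \<int>" "m \<in> \<int>"
  shows "harmonic \<gamma> (x + m) = harmonic \<gamma> x"
proof -
  obtain q where q: "\<gamma> * m = of_int q" using assms by (meson Ints_cases Ints_mult)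
  have "harmonic \<gamma> (x + m) = harmonic \<gamma> x * harmonic 1 (\<gamma> * m)"
    by (simp add: harmonic_def exp_add[symmetric] algebra_simps)
  also have "harmonic 1 (\<gamma> * m) = 1"
    unfolding q harmonic_def by (subst exp_eq_1) auto
  finally show ?thesis by simp
qed

text \<open>
  For \<open>\<gamma> \<noteq> 0\<close> the primitive is a multiple of the harmonic itself, hence has the same value at \<open>0\<close> and \<open>1\<close>.
\<close>

lemma integral_harmonic:
  assumes "\<gamma> \<in> \<int>"
  shows "(LBINT x:{0..1}. harmonic \<gamma> x) = of_bool (\<gamma> = 0)"
proof (cases "\<gamma> = 0")
  case True
  thus ?thesis by (simp add: harmonic_def set_lebesgue_integral_def)
next
  case False
  define c where "c = 2 * complex_of_real pi * \<i> * complex_of_real \<gamma>"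
  have c: "c \<noteq> 0" using False by (simp add: c_def)
  have h: "harmonic \<gamma> x = exp (c * of_real x)" for x
    by (simp add: harmonic_def c_def mult_ac)
  have "(LBINT x:{0..1}. harmonic \<gamma> x) = exp (c * of_real 1) / c - exp (c * of_real 0) / c"
    unfolding set_lebesgue_integral_def
    by (rule integral_FTC_Icc)
       (auto intro!: derivative_eq_intros continuous_intros has_vector_derivative_real_field simp: h c)
  also have "exp (c * of_real 1) = harmonic \<gamma> (0 + 1)" by (simp add: h)
  also have "\<dots> = 1" using assms by (subst harmonic_add_int) (auto simp: harmonic_def)
  finally show ?thesis using False by simp
qed

lemma integrable_lborel_bounded_support:
  fixes f :: "real \<Rightarrow> 'b::{banach, second_countable_topology}"
  assumes "f \<in> borel_measurable borel" and "\<And>x. norm (f x) \<le> C * indicator {a..b} x"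
  shows "integrable lborel f"
proof (rule Bochner_Integration.integrable_bound)
  show "integrable lborel (\<lambda>x. C * indicator {a..b} x :: real)"
    by (intro integrable_mult_right integrable_real_indicator) (auto simp: emeasure_lborel_Icc_eq)
  show "AE x in lborel. norm (f x) \<le> norm (C * indicator {a..b} x :: real)"
    using assms(2) by (intro AE_I2) (metis abs_ge_self order_trans real_norm_def)
qed (use assms(1) in simp)

lemma borel_measurable_cnj [measurable (raw)]:
  "f \<in> borel_measurable M \<Longrightarrow> (\<lambda>x. cnj (f x)) \<in> borel_measurable M"
  by (rule measurable_compose[OF _ borel_measurable_continuous_onI[OF continuous_on_cnj[OF continuous_on_id]]])

lemma bessel_harmonic:
  fixes v :: "real \<Rightarrow> complex"
  assumes Z: "finite Z" "Z \<subseteq> \<int>" and v: "v \<in> borel_measurable borel"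
    and bnd: "\<And>x. norm (v x) \<le> C" and supp: "\<And>x. x \<notin> {0..1} \<Longrightarrow> v x = 0"
  shows "(\<Sum>\<gamma>\<in>Z. (norm (\<integral>x. v x * cnj (harmonic \<gamma> x) \<partial>lborel))\<^sup>2) \<le> (\<integral>x. (norm (v x))\<^sup>2 \<partial>lborel)"
proof -
  \<comment> \<open>The harmonics are orthonormal only on the unit interval, which contains the support of \<open>v\<close>.\<close>
  define e :: "real \<Rightarrow> real \<Rightarrow> complex" where "e \<gamma> x = indicator {0..1} x * harmonic \<gamma> x" for \<gamma> x
  have e_meas [measurable]: "e \<gamma> \<in> borel_measurable borel" for \<gamma> unfolding e_def by measurable
  note [measurable] = v
  have C: "0 \<le> C" using order_trans[OF norm_ge_zero bnd[of 0]] .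
  have ve: "v x * cnj (e \<gamma> x) = v x * cnj (harmonic \<gamma> x)" for \<gamma> x
    using supp[of x] by (auto simp: e_def indicator_def)
  have ee: "e \<alpha> x * cnj (e \<beta> x) = indicator {0..1} x *\<^sub>R harmonic (\<alpha> - \<beta>) x" for \<alpha> \<beta> x
    using harmonic_mult_cnj[of \<alpha> x \<beta>] by (auto simp: e_def indicator_def)
  have "(\<Sum>\<gamma>\<in>Z. (norm (\<integral>x. v x * cnj (e \<gamma> x) \<partial>lborel))\<^sup>2) \<le> (\<integral>x. (norm (v x))\<^sup>2 \<partial>lborel)"
  proof (rule bessel_inequality[OF Z(1)])
    show "integrable lborel (\<lambda>x. (norm (v x))\<^sup>2)"
      by (rule integrable_lborel_bounded_support[where C = "C\<^sup>2" and a = 0 and b = 1])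
         (use bnd supp in \<open>auto simp: indicator_def intro!: power_mono\<close>)
    show "integrable lborel (\<lambda>x. v x * cnj (e \<gamma> x))" for \<gamma>
      by (rule integrable_lborel_bounded_support[where C = C and a = 0 and b = 1])
         (use bnd supp in \<open>auto simp: indicator_def ve norm_mult\<close>)
    show "integrable lborel (\<lambda>x. e \<alpha> x * cnj (e \<beta> x))" for \<alpha> \<beta>
      by (rule integrable_lborel_bounded_support[where C = 1 and a = 0 and b = 1])
         (auto simp: indicator_def ee)
    show "(\<integral>x. e \<alpha> x * cnj (e \<beta> x) \<partial>lborel) = of_bool (\<alpha> = \<beta>)" if "\<alpha> \<in> Z" "\<beta> \<in> Z" for \<alpha> \<beta>
    proof -
      have "\<alpha> - \<beta> \<in> \<int>" using that Z(2) by (intro Ints_diff) auto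
      from integral_harmonic[OF this] show ?thesis
        unfolding ee set_lebesgue_integral_def by simp
    qed
  qed
  thus ?thesis by (simp only: ve)
qed


section \<open>The envelope of a window\<close>

text \<open>
  Continuity turns the essential supremum over an open interval into a pointwise bound on its
  closure: a violation at one point of the closure persists on a nonempty open part of the interval,
  which has positive measure.
\<close>

lemma continuous_norm_le_esssup:
  fixes g :: "real \<Rightarrow> complex"
  assumes "continuous_on UNIV g" "a < b" "t \<in> {a..b}"
  shows "ennreal (norm (g t)) \<le> Lp_norm \<infinity> (restrict_space lborel {a<..<b}) g"
proof (rule ccontr)
  define E where "E = Lp_norm \<infinity> (restrict_space lborel {a<..<b}) g"
  assume "\<not> ?thesis"
  hence lt: "E < ennreal (norm (g t))" by (simp add: E_def)
  define r where "r = enn2real E"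
  have "E < top" using lt by (rule order.strict_trans) simp
  hence E: "E = ennreal r" by (simp add: r_def)
  have r: "0 \<le> r" "r < norm (g t)"
    using lt unfolding E by (auto simp: r_def ennreal_less_iff)
  define S where "S = {x. r < norm (g x)} \<inter> {a<..<b}"
  have "open {x. r < norm (g x)}"
    using assms(1) by (intro open_Collect_less continuous_intros)
  hence "open S" by (simp add: S_def open_Int)
  have "AE x in lborel. x \<in> {a<..<b} \<longrightarrow> ennreal (norm (g x)) \<le> E"
    using esssup_AE[where M = "restrict_space lborel {a<..<b}" and f = "\<lambda>x. ennreal (norm (g x))"]
    by (simp add: AE_restrict_space_iff E_def Lp_norm_def)
  hence "AE x in lborel. x \<notin> S"
    by (rule AE_mp) (auto simp: S_def E r ennreal_le_iff intro!: AE_I2)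
  hence "S \<in> null_sets lborel"
    using \<open>open S\<close> by (subst (asm) AE_iff_null_sets[symmetric]) auto
  hence "negligible S"
    using negligible_iff_null_sets null_sets_completionI by blast
  hence "S = {}" using \<open>open S\<close> open_not_negligible by blast
  moreover have "t \<in> closure {a<..<b}" using assms(2,3) by simp
  hence "{x. r < norm (g x)} \<inter> {a<..<b} \<noteq> {}"
    using \<open>open {x. r < norm (g x)}\<close> r(2) by (auto simp: closure_iff_nhds_not_empty)
  ultimately show False by (simp add: S_def)
qed

lemma W0_envelope:
  assumes "g \<in> W0"
  obtains \<gamma> :: "int \<Rightarrow> real"
  where "\<And>t. norm (g t) \<le> \<gamma> \<lfloor>t\<rfloor>" "\<gamma> summable_on UNIV"
proof
  define E where "E m = Lp_norm \<infinity> (restrict_space lborel {real_of_int m<..<real_of_int m + 1}) g" for m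
  have cont: "continuous_on UNIV g" and fin: "(\<Sum>\<^sub>\<infinity>m. E m) < \<infinity>"
    using assms by (auto simp: W0_def E_def)
  have sum_le: "sum E F \<le> (\<Sum>\<^sub>\<infinity>m. E m)" if "finite F" for F
    using infsum_mono_neutral[of E F E UNIV] that by (simp add: nonneg_summable_on_complete)
  have E_fin: "E m < \<infinity>" for m
    using le_less_trans[OF sum_le[of "{m}"] fin] by simp
  have E_eq: "E m = ennreal (enn2real (E m))" for m
    using E_fin[of m] by simp
  show "norm (g t) \<le> enn2real (E \<lfloor>t\<rfloor>)" for t
  proof -
    have "ennreal (norm (g t)) \<le> E \<lfloor>t\<rfloor>"
      unfolding E_def by (rule continuous_norm_le_esssup[OF cont]) (auto simp: floor_correct less_imp_le)
    thus ?thesis by (subst (asm) E_eq) simp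
  qed
  show "(\<lambda>m. enn2real (E m)) summable_on UNIV"
  proof (rule nonneg_bdd_above_summable_on)
    show "bdd_above (sum (\<lambda>m. enn2real (E m)) ` {F. F \<subseteq> UNIV \<and> finite F})"
    proof (intro bdd_aboveI2)
      fix F :: "int set" assume "F \<in> {F. F \<subseteq> UNIV \<and> finite F}"
      hence F: "finite F" by simp
      have "ennreal (\<Sum>m\<in>F. enn2real (E m)) = sum E F"
        by (simp add: E_eq[symmetric] flip: sum_ennreal)
      also have "\<dots> \<le> ennreal (enn2real (\<Sum>\<^sub>\<infinity>m. E m))"
        using sum_le[OF F] fin by simp
      finally show "(\<Sum>m\<in>F. enn2real (E m)) \<le> enn2real (\<Sum>\<^sub>\<infinity>m. E m)"
        by (simp add: ennreal_le_iff)
    qed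
  qed auto
qed

section \<open>Series of integer shifts of a dominated window\<close>

text \<open>
  Indexing the envelope by the integer part makes it possible to compare values of \<open>g\<close> at arbitrary real points with a convolution on \<open>\<int>\<close>.
\<close>

locale dominated_window =
  fixes g :: "real \<Rightarrow> complex" and \<gamma> :: "int \<Rightarrow> real"
  assumes norm_g_le: "norm (g t) \<le> \<gamma> \<lfloor>t\<rfloor>"
    and \<gamma>_summable: "\<gamma> summable_on UNIV"
    and continuous_g: "continuous_on UNIV g"
begin

definition shift_series :: "(int \<Rightarrow> complex) \<Rightarrow> real \<Rightarrow> complex" where
  "shift_series c t = (\<Sum>\<^sub>\<infinity>n. c n * g (t - of_int n))"

abbreviation trunc :: "int \<Rightarrow> (int \<Rightarrow> complex) \<Rightarrow> int \<Rightarrow> complex" where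
  "trunc N c n \<equiv> complex_of_real (cut N n) * c n"

lemma \<gamma>_nonneg: "0 \<le> \<gamma> m"
  using norm_g_le[of "of_int m"] norm_ge_zero[of "g (of_int m)"] by (simp del: norm_ge_zero)

lemma \<gamma>_has_sum_reflected: "((\<lambda>n. \<gamma> (p - n)) has_sum infsum \<gamma> UNIV) UNIV"
  by (rule has_sum_reindex_bij_witness[of _ "\<lambda>n. p - n" "\<lambda>n. p - n", THEN iffD2, OF _ _ _ _ _ refl has_sum_infsum[OF \<gamma>_summable]])
     auto

lemmas \<gamma>_reflected_summable = has_sum_imp_summable[OF \<gamma>_has_sum_reflected]

lemma norm_g_shift_le: "norm (g (t - of_int n)) \<le> \<gamma> (\<lfloor>t\<rfloor> - n)"
  using norm_g_le[of "t - of_int n"] by simp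

lemma norm_shift_series_term_le:
  assumes "\<And>n. norm (c n) \<le> C"
  shows "norm (c n * g (t - of_int n)) \<le> C * \<gamma> (\<lfloor>t\<rfloor> - n)"
  unfolding norm_mult using assms norm_g_shift_le
  by (intro mult_mono) (auto intro: order_trans[OF norm_ge_zero])

lemma shift_series_abs_summable:
  assumes "\<And>n. norm (c n) \<le> C"
  shows "(\<lambda>n. norm (c n * g (t - of_int n))) summable_on UNIV"
  by (rule summable_on_comparison_test[OF summable_on_cmult_right[OF \<gamma>_reflected_summable, where c = C]])
     (use norm_shift_series_term_le[OF assms] in auto)

lemma shift_series_summable:
  assumes "\<And>n. norm (c n) \<le> C"
  shows "(\<lambda>n. c n * g (t - of_int n)) summable_on UNIV"
  using shift_series_abs_summable[OF assms] by (rule abs_summable_summable)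

lemma norm_shift_series_le:
  assumes "\<And>n. norm (c n) \<le> C"
  shows "norm (shift_series c t) \<le> C * infsum \<gamma> UNIV"
proof -
  have "norm (shift_series c t) \<le> (\<Sum>\<^sub>\<infinity>n. norm (c n * g (t - of_int n)))"
    unfolding shift_series_def by (rule norm_infsum_bound[OF shift_series_abs_summable[OF assms]])
  also have "\<dots> \<le> (\<Sum>\<^sub>\<infinity>n. C * \<gamma> (\<lfloor>t\<rfloor> - n))"
    by (intro infsum_mono shift_series_abs_summable[OF assms] summable_on_cmult_right \<gamma>_reflected_summable norm_shift_series_term_le assms)
  also have "\<dots> = C * infsum \<gamma> UNIV"
    using infsumI[OF \<gamma>_has_sum_reflected] by (simp add: infsum_cmult_right')
  finally show ?thesis .
qed

lemma shift_series_trunc_eq: "shift_series (trunc N c) t = (\<Sum>n\<in>{-N..N}. c n * g (t - of_int n))"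
proof -
  have "shift_series (trunc N c) t = (\<Sum>\<^sub>\<infinity>n\<in>{-N..N}. c n * g (t - of_int n))"
    unfolding shift_series_def by (rule infsum_cong_neutral) (auto simp: cut_def)
  thus ?thesis by simp
qed

lemma norm_trunc_le:
  assumes "\<And>n. norm (c n) \<le> C"
  shows "norm (trunc N c n) \<le> C"
  using assms[of n] order_trans[OF norm_ge_zero assms[of n]] by (auto simp: cut_def)

text \<open>
  At a point with integer part \<open>p\<close> the series of the truncated sequence differs from the truncated
  series by the terms \<open>(cut N n - cut N p) * c n * g (t - n)\<close>, which are nonzero only if exactly one
  of \<open>n\<close> and \<open>p\<close> lies in \<open>[-N, N]\<close>.
\<close>

lemma norm_shift_series_trunc_diff_le:
  assumes "\<And>n. norm (c n) \<le> C"
  shows "norm (shift_series (trunc N c) t - cut N \<lfloor>t\<rfloor> * shift_series c t)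
    \<le> C * (\<Sum>\<^sub>\<infinity>n. \<gamma> (\<lfloor>t\<rfloor> - n) * \<bar>cut N n - cut N \<lfloor>t\<rfloor>\<bar>)"
proof -
  define w where "w n = cut N n - cut N \<lfloor>t\<rfloor>" for n
  have C: "0 \<le> C" using order_trans[OF norm_ge_zero assms[of 0]] .
  have b: "norm (complex_of_real (w n) * (c n * g (t - of_int n))) \<le> C * (\<gamma> (\<lfloor>t\<rfloor> - n) * \<bar>w n\<bar>)" for n
    using mult_right_mono[OF norm_shift_series_term_le[where c = c and n = n and t = t, OF assms], of "\<bar>w n\<bar>"] by (simp add: norm_mult mult_ac)
  have s: "(\<lambda>n. C * (\<gamma> (\<lfloor>t\<rfloor> - n) * \<bar>w n\<bar>)) summable_on UNIV"
    by (rule summable_on_comparison_test[OF summable_on_cmult_right[OF \<gamma>_reflected_summable, where c = C]])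
       (auto simp: w_def cut_def \<gamma>_nonneg C)
  have s': "(\<lambda>n. norm (complex_of_real (w n) * (c n * g (t - of_int n)))) summable_on UNIV"
    by (rule summable_on_comparison_test[OF s b]) auto
  have "((\<lambda>n. trunc N c n * g (t - of_int n) + - (cut N \<lfloor>t\<rfloor> * (c n * g (t - of_int n)))) has_sum
      (shift_series (trunc N c) t + - (cut N \<lfloor>t\<rfloor> * shift_series c t))) UNIV"
    unfolding shift_series_def
    by (intro has_sum_add has_sum_uminusI has_sum_cmult_right has_sum_infsum shift_series_summable[OF assms] shift_series_summable[OF norm_trunc_le[OF assms]])
  hence "shift_series (trunc N c) t - cut N \<lfloor>t\<rfloor> * shift_series c t = (\<Sum>\<^sub>\<infinity>n. complex_of_real (w n) * (c n * g (t - of_int n)))"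
    by (subst infsumI[symmetric]) (auto simp: w_def algebra_simps)
  also have "norm \<dots> \<le> (\<Sum>\<^sub>\<infinity>n. norm (complex_of_real (w n) * (c n * g (t - of_int n))))"
    by (rule norm_infsum_bound[OF s'])
  also have "\<dots> \<le> (\<Sum>\<^sub>\<infinity>n. C * (\<gamma> (\<lfloor>t\<rfloor> - n) * \<bar>w n\<bar>))"
    by (rule infsum_mono[OF s' s b])
  also have "\<dots> = C * (\<Sum>\<^sub>\<infinity>n. \<gamma> (\<lfloor>t\<rfloor> - n) * \<bar>w n\<bar>)"
    by (simp add: infsum_cmult_right')
  finally show ?thesis by (simp add: w_def)
qed

text \<open>
  On an interval of length one the integer part takes at most two values, so two
  translates of the envelope majorise the series and it converges uniformly.
\<close>

lemma continuous_on_shift_series: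
  assumes "\<And>n. norm (c n) \<le> C"
  shows "continuous_on {a..a+1} (shift_series c)"
proof -
  define M where "M n = C * (\<gamma> (\<lfloor>a\<rfloor> - n) + \<gamma> (\<lfloor>a\<rfloor> + 1 - n))" for n
  have C: "0 \<le> C" using order_trans[OF norm_ge_zero assms[of 0]] .
  have "M summable_on UNIV"
    unfolding M_def by (intro summable_on_cmult_right summable_on_add \<gamma>_reflected_summable)
  have M: "norm (c n * g (t - of_int n)) \<le> M n" if "t \<in> {a..a+1}" for n t
  proof -
    have "\<lfloor>t\<rfloor> = \<lfloor>a\<rfloor> \<or> \<lfloor>t\<rfloor> = \<lfloor>a\<rfloor> + 1" using that by (simp; linarith)
    hence "C * \<gamma> (\<lfloor>t\<rfloor> - n) \<le> M n"
      unfolding M_def by (intro mult_left_mono C) (auto simp: \<gamma>_nonneg)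
    thus ?thesis using norm_shift_series_term_le[where c = c and n = n and t = t, OF assms] by linarith
  qed
  have "uniform_limit {a..a+1} (\<lambda>X t. \<Sum>n\<in>X. c n * g (t - of_int n)) (shift_series c) (finite_subsets_at_top UNIV)"
    unfolding shift_series_def by (rule Weierstrass_m_test_general[OF M \<open>M summable_on UNIV\<close>])
  thus ?thesis
    by (rule uniform_limit_theorem[rotated])
       (auto intro!: always_eventually continuous_intros continuous_on_compose2[OF continuous_g])
qed

text \<open>
  One factor of the square is bounded uniformly, so that the other can be summed in the \<open>\<ell>\<^sup>1\<close> sense,
  which is what \<open>sum_cut_commutator_le\<close> controls.  The points of \<open>T\<close> have distinct integer
  parts; thus a sum over \<open>T\<close> of a function of the integer part is a sum over a finite set of integers.
\<close>

lemma sum_norm_shift_series_trunc_le: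
  assumes c: "\<And>n. norm (c n) \<le> C"
    and T: "finite T" "inj_on floor T" "\<And>t. t \<in> T \<Longrightarrow> norm (shift_series c t) \<le> \<eta>"
    and N: "0 \<le> N" and B: "\<And>m. m \<in> B \<Longrightarrow> \<bar>m\<bar> \<le> K" and K: "0 \<le> K" and \<eta>: "0 \<le> \<eta>"
  shows "(\<Sum>t\<in>T. (norm (shift_series (trunc N c) t))\<^sup>2) \<le> C * infsum \<gamma> UNIV * ((2 * of_int N + 1) * \<eta>
      + C * (2 * of_int K * infsum \<gamma> UNIV + (4 * of_int N + 2) * infsum \<gamma> (- B)))"
proof -
  define S where "S p = (\<Sum>\<^sub>\<infinity>n. \<gamma> (p - n) * \<bar>cut N n - cut N p\<bar>)" for p
  define M where "M = C * infsum \<gamma> UNIV"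
  have C: "0 \<le> C" using order_trans[OF norm_ge_zero c[of 0]] .
  have M: "0 \<le> M" unfolding M_def using C \<gamma>_nonneg by (intro mult_nonneg_nonneg infsum_nonneg)
  have pt: "(norm (shift_series (trunc N c) t))\<^sup>2 \<le> M * (cut N \<lfloor>t\<rfloor> * \<eta> + C * S \<lfloor>t\<rfloor>)" if "t \<in> T" for t
  proof -
    have "norm (shift_series (trunc N c) t)
        \<le> norm (complex_of_real (cut N \<lfloor>t\<rfloor>) * shift_series c t) + norm (shift_series (trunc N c) t - cut N \<lfloor>t\<rfloor> * shift_series c t)"
      by (metis add_diff_cancel_left' add_diff_eq norm_triangle_ineq)
    also have "\<dots> \<le> cut N \<lfloor>t\<rfloor> * \<eta> + C * S \<lfloor>t\<rfloor>"
      using norm_shift_series_trunc_diff_le[where c = c and N = N and t = t, OF c] T(3)[OF that] \<eta>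
      by (intro add_mono) (auto simp: S_def cut_def norm_mult)
    finally have "norm (shift_series (trunc N c) t) \<le> cut N \<lfloor>t\<rfloor> * \<eta> + C * S \<lfloor>t\<rfloor>" .
    moreover have "norm (shift_series (trunc N c) t) \<le> M"
      unfolding M_def by (rule norm_shift_series_le[OF norm_trunc_le[OF c]])
    ultimately show ?thesis unfolding power2_eq_square using M by (intro mult_mono) auto
  qed
  have "(\<Sum>t\<in>T. (norm (shift_series (trunc N c) t))\<^sup>2) \<le> (\<Sum>t\<in>T. M * (cut N \<lfloor>t\<rfloor> * \<eta> + C * S \<lfloor>t\<rfloor>))"
    by (rule sum_mono[OF pt])
  also have "\<dots> = M * ((\<Sum>p\<in>floor ` T. cut N (p - 0)) * \<eta> + C * (\<Sum>p\<in>floor ` T. S p))"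
    by (simp add: sum.reindex[OF T(2)] sum.distrib sum_distrib_left sum_distrib_right o_def distrib_left)
  also have "\<dots> \<le> M * ((2 * of_int N + 1) * \<eta> + C * (2 * of_int K * infsum \<gamma> UNIV + (4 * of_int N + 2) * infsum \<gamma> (- B)))"
    unfolding S_def using T(1)
    by (intro mult_left_mono add_mono mult_right_mono sum_cut_le sum_cut_commutator_le N M C \<eta> \<gamma>_nonneg \<gamma>_summable B K) auto
  finally show ?thesis by (simp add: M_def)
qed

end

section \<open>The frame inequality on combs\<close>

text \<open>
  Bumps of width \<open>\<delta>\<close> at the integers of \<open>[-N, N]\<close>, with heights \<open>d n\<close>; for \<open>\<delta> \<le> 1\<close> they are disjoint.
\<close>

definition comb :: "real \<Rightarrow> int \<Rightarrow> (int \<Rightarrow> complex) \<Rightarrow> real \<Rightarrow> complex" where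
  "comb \<delta> N d x = (\<Sum>n\<in>{-N..N}. indicator {0..<\<delta>} (x - of_int n) * d n)"

lemma comb_measurable [measurable]: "comb \<delta> N d \<in> borel_measurable borel"
  unfolding comb_def by measurable

lemma Lp_norm_2_lborel_square:
  assumes "f \<in> borel_measurable borel" "integrable lborel (\<lambda>x. (norm (f x))\<^sup>2)"
  shows "(Lp_norm 2 lborel f)\<^sup>2 = ennreal (\<integral>x. (norm (f x))\<^sup>2 \<partial>lborel)"
    and "f \<in> Lp 2 lborel"
proof -
  define I where "I = (\<integral>x. (norm (f x))\<^sup>2 \<partial>lborel)"
  have I: "0 \<le> I" by (simp add: I_def)
  have "(\<integral>\<^sup>+x. ennreal (norm (f x) powr 2) \<partial>lborel) = ennreal I"
    unfolding I_def using nn_integral_eq_integral[OF assms(2)] by simp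
  hence *: "Lp_norm 2 lborel f = ennreal (sqrt I)"
    using I by (simp add: Lp_norm_def powr_half_sqrt)
  show "(Lp_norm 2 lborel f)\<^sup>2 = ennreal I"
    using I by (simp add: * ennreal_power)
  show "f \<in> Lp 2 lborel"
    using assms(1) by (simp add: Lp_def *)
qed

lemma norm_comb_square:
  assumes "\<delta> \<le> 1"
  shows "(norm (comb \<delta> N d x))\<^sup>2 = (\<Sum>n\<in>{-N..N}. indicator {0..<\<delta>} (x - of_int n) * (norm (d n))\<^sup>2)"
proof -
  have "x - of_int n \<notin> {0..<\<delta>}" if "n \<noteq> \<lfloor>x\<rfloor>" for n
    using that assms by (simp; linarith)
  hence only: "indicator {0..<\<delta>} (x - of_int n) = (0::real)"
      "indicator {0..<\<delta>} (x - of_int n) = (0::complex)" if "n \<noteq> \<lfloor>x\<rfloor>" for n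
    using that by (metis indicator_simps(2))+
  show ?thesis
  proof (cases "\<lfloor>x\<rfloor> \<in> {-N..N}")
    case True
    have "(\<Sum>n\<in>{-N..N} - {\<lfloor>x\<rfloor>}. indicator {0..<\<delta>} (x - of_int n) * d n) = 0"
      by (intro sum.neutral ballI) (metis only(2) DiffE singletonI mult_zero_left)
    hence "comb \<delta> N d x = indicator {0..<\<delta>} (x - of_int \<lfloor>x\<rfloor>) * d \<lfloor>x\<rfloor>"
      unfolding comb_def by (subst sum.remove[OF _ True]) auto
    moreover have "(\<Sum>n\<in>{-N..N} - {\<lfloor>x\<rfloor>}. indicator {0..<\<delta>} (x - of_int n) * (norm (d n))\<^sup>2) = 0"
      by (intro sum.neutral ballI) (metis only(1) DiffE singletonI mult_zero_left)
    hence "(\<Sum>n\<in>{-N..N}. indicator {0..<\<delta>} (x - of_int n) * (norm (d n))\<^sup>2)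
        = indicator {0..<\<delta>} (x - of_int \<lfloor>x\<rfloor>) * (norm (d \<lfloor>x\<rfloor>))\<^sup>2"
      by (subst sum.remove[OF _ True]) auto
    ultimately show ?thesis by (simp add: indicator_def)
  next
    case False
    have "comb \<delta> N d x = 0"
      unfolding comb_def using False by (intro sum.neutral ballI) (metis only mult_zero_left)
    moreover have "(\<Sum>n\<in>{-N..N}. indicator {0..<\<delta>} (x - of_int n) * (norm (d n))\<^sup>2) = 0"
      using False by (intro sum.neutral ballI) (metis only mult_zero_left)
    ultimately show ?thesis by simp
  qed
qed

lemma has_bochner_integral_indicator_shift:
  assumes "0 \<le> \<delta>"
  shows "has_bochner_integral lborel (\<lambda>x. indicator {0..<\<delta>} (x - r) :: real) \<delta>"
proof -
  have "(\<lambda>x. indicator {0..<\<delta>} (x - r) :: real) = indicator {r..<r+\<delta>}"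
    by (auto simp: fun_eq_iff indicator_def)
  thus ?thesis using assms has_bochner_integral_real_indicator[of "{r..<r+\<delta>}" lborel] by simp
qed

lemma comb_in_L2:
  assumes "0 \<le> \<delta>" "\<delta> \<le> 1"
  shows "comb \<delta> N d \<in> Lp 2 lborel"
    and "(Lp_norm 2 lborel (comb \<delta> N d))\<^sup>2 = ennreal (\<delta> * (\<Sum>n\<in>{-N..N}. (norm (d n))\<^sup>2))"
proof -
  have h: "has_bochner_integral lborel (\<lambda>x. (norm (comb \<delta> N d x))\<^sup>2) (\<Sum>n\<in>{-N..N}. \<delta> * (norm (d n))\<^sup>2)"
    unfolding norm_comb_square[OF assms(2)]
    by (intro has_bochner_integral_sum has_bochner_integral_mult_left has_bochner_integral_indicator_shift assms(1))
  note i = h[THEN has_bochner_integral_iff[THEN iffD1]]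
  show "comb \<delta> N d \<in> Lp 2 lborel"
    by (rule Lp_norm_2_lborel_square(2)) (use i in auto)
  show "(Lp_norm 2 lborel (comb \<delta> N d))\<^sup>2 = ennreal (\<delta> * (\<Sum>n\<in>{-N..N}. (norm (d n))\<^sup>2))"
    using Lp_norm_2_lborel_square(1)[of "comb \<delta> N d"] i by (simp add: sum_distrib_left)
qed

context dominated_window
begin

lemma shift_series_trunc_continuous: "continuous_on UNIV (shift_series (trunc N c))"
  unfolding shift_series_trunc_eq[abs_def]
  by (auto intro!: continuous_intros continuous_on_compose2[OF continuous_g])

text \<open>
  Periodization: the integer frequency \<open>z\<close> does not see integer translations, so all bumps of the comb
  can be moved to \<open>[0, \<delta>)\<close>, where they add up to a shift series.  Its argument is \<open>x - l + n\<close>; reflecting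
  and conjugating the sequence \<open>c\<close> in the comb restores the convention \<open>c n * g (t - n)\<close>.
\<close>

lemma inner_comb_gabor:
  assumes "z \<in> \<int>"
  shows "L2_inner (comb \<delta> N (\<lambda>n. cnj (c (- n)))) (gabor g (l, z))
    = (\<integral>x. indicator {0..<\<delta>} x * cnj (shift_series (trunc N c) (x - l)) * cnj (harmonic z x) \<partial>lborel)"
proof -
  define F where "F n x = indicator {0..<\<delta>} (x - of_int n) * cnj (c (- n)) * cnj (g (x - l)) * cnj (harmonic z x)" for n x
  define G where "G n x = indicator {0..<\<delta>} x * cnj (c (- n)) * cnj (g (x - l + of_int n)) * cnj (harmonic z x)" for n x
  have [measurable]: "g \<in> borel_measurable borel"
    by (rule borel_measurable_continuous_onI[OF continuous_g])
  have FG: "F n (of_int n + x) = G n x" for n x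
    using harmonic_add_int[OF assms, of "of_int n" x] by (simp add: F_def G_def algebra_simps)
  have [measurable]: "G n \<in> borel_measurable borel" for n
    unfolding G_def by measurable
  have G: "integrable lborel (G n)" for n
  proof -
    have "bounded ((\<lambda>x. g (x - l + of_int n)) ` {0..\<delta>})"
      by (intro compact_imp_bounded compact_continuous_image continuous_on_compose2[OF continuous_g] continuous_intros) auto
    then obtain K where K: "\<And>x. x \<in> {0..\<delta>} \<Longrightarrow> norm (g (x - l + of_int n)) \<le> K"
      unfolding bounded_iff by blast
    show ?thesis
      by (rule integrable_lborel_bounded_support[where C = "norm (c (- n)) * max K 0" and a = 0 and b = \<delta>])
         (use K in \<open>auto simp: G_def norm_mult indicator_def le_max_iff_disj intro!: mult_left_mono\<close>)
  qed
  have F: "integrable lborel (F n)" for n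
    using lborel_integrable_real_affine_iff[of 1 "F n" "of_int n"] G[of n] by (simp add: FG)
  have "L2_inner (comb \<delta> N (\<lambda>n. cnj (c (- n)))) (gabor g (l, z)) = (\<integral>x. (\<Sum>n\<in>{-N..N}. F n x) \<partial>lborel)"
    unfolding L2_inner_def comb_def gabor_def F_def harmonic_def
    by (simp only: sum_distrib_right prod.case complex_cnj_mult mult.assoc)
  also have "\<dots> = (\<Sum>n\<in>{-N..N}. \<integral>x. F n x \<partial>lborel)"
    by (rule Bochner_Integration.integral_sum[OF F])
  also have "\<dots> = (\<Sum>n\<in>{-N..N}. \<integral>x. G n x \<partial>lborel)"
  proof (intro sum.cong refl)
    show "(\<integral>x. F n x \<partial>lborel) = (\<integral>x. G n x \<partial>lborel)" for n
      using lborel_integral_real_affine[of 1 "F n" "of_int n"] by (simp add: FG)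
  qed
  also have "\<dots> = (\<integral>x. (\<Sum>n\<in>{-N..N}. G n x) \<partial>lborel)"
    by (rule Bochner_Integration.integral_sum[OF G, symmetric])
  also have "(\<lambda>x. \<Sum>n\<in>{-N..N}. G n x)
      = (\<lambda>x. indicator {0..<\<delta>} x * cnj (shift_series (trunc N c) (x - l)) * cnj (harmonic z x))"
  proof
    fix x
    have "cnj (shift_series (trunc N c) (x - l)) = (\<Sum>n\<in>{-N..N}. cnj (c n * g (x - l - of_int n)))"
      by (simp add: shift_series_trunc_eq)
    also have "\<dots> = (\<Sum>n\<in>{-N..N}. cnj (c (- n)) * cnj (g (x - l + of_int n)))"
      by (rule sum.reindex_bij_witness[of _ uminus uminus]) auto
    finally show "(\<Sum>n\<in>{-N..N}. G n x) = indicator {0..<\<delta>} x * cnj (shift_series (trunc N c) (x - l)) * cnj (harmonic z x)"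
      by (simp add: G_def sum_distrib_left sum_distrib_right mult_ac)
  qed
  finally show ?thesis .
qed

text \<open>
  For a comb of width \<open>\<delta>\<close> the lower frame inequality and Bessel's inequality compare two quantities
  proportional to \<open>\<delta>\<close>, which therefore cancels; what remains is a bound for the truncated sequence
  in terms of samples of its series.  The samples may be taken for \<open>x\<close> in an arbitrarily short interval \<open>[0, \<delta>)\<close>.
\<close>

lemma frame_coefficient_bound:
  assumes frame: "L2_frame (\<Lambda> \<times> \<int>) (gabor g)"
  obtains A :: real where "A > 0"
    and "\<And>\<delta> N c R C. 0 < \<delta> \<Longrightarrow> \<delta> \<le> 1 \<Longrightarrow> (\<And>n. norm (c n) \<le> C) \<Longrightarrow>
      (\<And>x L. x \<in> {0..<\<delta>} \<Longrightarrow> finite L \<Longrightarrow> L \<subseteq> \<Lambda> \<Longrightarrow> (\<Sum>l\<in>L. (norm (shift_series (trunc N c) (x - l)))\<^sup>2) \<le> R) \<Longrightarrow>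
      A * (\<Sum>n\<in>{-N..N}. (norm (c n))\<^sup>2) \<le> R"
proof -
  from frame obtain A where A: "A > 0" and low: "\<And>f. f \<in> Lp 2 lborel \<Longrightarrow> 
      ennreal A * (Lp_norm 2 lborel f)\<^sup>2 \<le> (\<Sum>\<^sub>\<infinity>i\<in>\<Lambda>\<times>\<int>. ennreal ((norm (L2_inner f (gabor g i)))\<^sup>2))"
    unfolding L2_frame_def by blast
  have "A * (\<Sum>n\<in>{-N..N}. (norm (c n))\<^sup>2) \<le> R" if \<delta>: "0 < \<delta>" "\<delta> \<le> 1" and c: "\<And>n. norm (c n) \<le> C"
    and R: "\<And>x L. x \<in> {0..<\<delta>} \<Longrightarrow> finite L \<Longrightarrow> L \<subseteq> \<Lambda> \<Longrightarrow> (\<Sum>l\<in>L. (norm (shift_series (trunc N c) (x - l)))\<^sup>2) \<le> R"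
    for \<delta> N c R C
  proof -
    define f where "f = comb \<delta> N (\<lambda>n. cnj (c (- n)))"
    define v where "v l x = indicator {0..<\<delta>} x * cnj (shift_series (trunc N c) (x - l))" for l x
    have f: "f \<in> Lp 2 lborel" unfolding f_def using \<delta> by (intro comb_in_L2) auto
    have "(\<Sum>n\<in>{-N..N}. (norm (cnj (c (- n))))\<^sup>2) = (\<Sum>n\<in>{-N..N}. (norm (c n))\<^sup>2)"
      by (rule sum.reindex_bij_witness[of _ uminus uminus]) auto
    hence norm_f: "(Lp_norm 2 lborel f)\<^sup>2 = ennreal (\<delta> * (\<Sum>n\<in>{-N..N}. (norm (c n))\<^sup>2))"
      unfolding f_def using \<delta> comb_in_L2(2)[of \<delta> N "\<lambda>n. cnj (c (- n))"] by simp
    have [measurable]: "shift_series (trunc N c) \<in> borel_measurable borel"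
      by (rule borel_measurable_continuous_onI[OF shift_series_trunc_continuous])
    have v_meas [measurable]: "v l \<in> borel_measurable borel" for l unfolding v_def by measurable
    have M: "norm (shift_series (trunc N c) t) \<le> C * infsum \<gamma> UNIV" for t
      by (rule norm_shift_series_le[OF norm_trunc_le[OF c]])
    have v_bnd: "norm (v l x) \<le> C * infsum \<gamma> UNIV" for l x
      using M[of "x - l"] order_trans[OF norm_ge_zero M] by (auto simp: v_def indicator_def)
    have v_int: "integrable lborel (\<lambda>x. (norm (v l x))\<^sup>2)" for l
      by (rule integrable_lborel_bounded_support[where C = "(C * infsum \<gamma> UNIV)\<^sup>2" and a = 0 and b = 1])
         (use v_bnd \<delta> in \<open>auto simp: v_def indicator_def intro!: power_mono M\<close>)
    have fin: "(\<Sum>i\<in>S. ennreal ((norm (L2_inner f (gabor g i)))\<^sup>2)) \<le> ennreal (\<delta> * R)"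
      if S: "finite S" "S \<subseteq> \<Lambda> \<times> \<int>" for S
    proof -
      define L Z where "L = fst ` S" and "Z = snd ` S"
      have LZ: "finite L" "finite Z" "L \<subseteq> \<Lambda>" "Z \<subseteq> \<int>" "S \<subseteq> L \<times> Z"
        using S by (auto simp: L_def Z_def image_iff) force+
      \<comment> \<open>A finite set of indices lies in a product of finite sets, on which Bessel applies to each \<open>l\<close> separately.\<close>
      have "(\<Sum>i\<in>S. (norm (L2_inner f (gabor g i)))\<^sup>2) \<le> (\<Sum>i\<in>L\<times>Z. (norm (L2_inner f (gabor g i)))\<^sup>2)"
        using LZ by (intro sum_mono2) auto
      also have "\<dots> = (\<Sum>l\<in>L. \<Sum>z\<in>Z. (norm (\<integral>x. v l x * cnj (harmonic z x) \<partial>lborel))\<^sup>2)"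
        unfolding sum.cartesian_product' f_def v_def
        using LZ(4) by (intro sum.cong refl) (simp add: inner_comb_gabor subsetD)
      also have "\<dots> \<le> (\<Sum>l\<in>L. \<integral>x. (norm (v l x))\<^sup>2 \<partial>lborel)"
        using \<delta> by (intro sum_mono bessel_harmonic[OF LZ(2,4) v_meas v_bnd]) (auto simp: v_def)
      also have "\<dots> = (\<integral>x. (\<Sum>l\<in>L. (norm (v l x))\<^sup>2) \<partial>lborel)"
        by (rule Bochner_Integration.integral_sum[OF v_int, symmetric])
      also have "\<dots> \<le> (\<integral>x. indicator {0..<\<delta>} (x - 0) * R \<partial>lborel)"
      proof (rule integral_mono)
        show "integrable lborel (\<lambda>x. \<Sum>l\<in>L. (norm (v l x))\<^sup>2)" using v_int by auto
        show "integrable lborel (\<lambda>x. indicator {0..<\<delta>} (x - 0) * R)"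
          using has_bochner_integral_indicator_shift[of \<delta> 0] \<delta>
          by (intro integrable_mult_left) (auto simp: has_bochner_integral_iff)
        show "(\<Sum>l\<in>L. (norm (v l x))\<^sup>2) \<le> indicator {0..<\<delta>} (x - 0) * R" for x
          using R[OF _ LZ(1,3), of x] by (auto simp: v_def indicator_def)
      qed
      also have "\<dots> = \<delta> * R"
        using has_bochner_integral_indicator_shift[of \<delta> 0] \<delta>
        by (intro has_bochner_integral_integral_eq has_bochner_integral_mult_left) auto
      finally show ?thesis by (simp add: sum_ennreal ennreal_leI)
    qed
    have "ennreal A * (Lp_norm 2 lborel f)\<^sup>2 \<le> ennreal (\<delta> * R)"
      by (rule order_trans[OF low[OF f]]) (intro infsum_le_finite_sums fin nonneg_summable_on_complete; simp)
    hence "ennreal (A * (\<delta> * (\<Sum>n\<in>{-N..N}. (norm (c n))\<^sup>2))) \<le> ennreal (\<delta> * R)"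
      using A \<delta> by (simp add: norm_f ennreal_mult' sum_nonneg)
    moreover have "0 \<le> R" using R[of 0 "{}"] \<delta> by simp
    ultimately have "\<delta> * (A * (\<Sum>n\<in>{-N..N}. (norm (c n))\<^sup>2)) \<le> \<delta> * R"
      using \<delta> by (simp add: mult_ac)
    thus ?thesis using \<delta> by simp
  qed
  with A that show ?thesis by blast
qed

end

section \<open>Zeros on a lattice exclude a frame\<close>

lemma periodic_of_int_mult:
  fixes f :: "'a::ring_1 \<Rightarrow> 'b"
  assumes "\<And>t. f (t + p) = f t"
  shows "f (t + of_int j * p) = f t"
proof (induction j rule: int_induct[where k = 0])
  case (step1 j)
  have "f (t + of_int (j + 1) * p) = f (t + of_int j * p + p)" by (simp add: algebra_simps)
  with step1 assms show ?case by simp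
next
  case (step2 j)
  have "f (t + of_int j * p) = f (t + of_int (j - 1) * p + p)" by (simp add: algebra_simps)
  with step2 assms show ?case by simp
qed simp

context dominated_window
begin

lemma shift_series_shift:
  assumes "\<And>n. c (n + p) = s * c n"
  shows "shift_series c (t + of_int p) = s * shift_series c t"
proof -
  have "shift_series c (t + of_int p) = (\<Sum>\<^sub>\<infinity>n. c (n + p) * g (t - of_int n))"
    unfolding shift_series_def by (rule infsum_reindex_bij_witness[of _ "\<lambda>n. n + p" "\<lambda>n. n - p"]) (auto simp: algebra_simps)
  thus ?thesis by (simp add: assms shift_series_def mult.assoc infsum_cmult_right')
qed

lemma shift_series_reflect:
  assumes "\<And>n. c (- n) = c n" "\<And>t. g (- t) = \<sigma> * g t"
  shows "shift_series c (- t) = \<sigma> * shift_series c t"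
proof -
  have "shift_series c (- t) = (\<Sum>\<^sub>\<infinity>n. \<sigma> * (c n * g (t - of_int n)))"
    unfolding shift_series_def
  proof (rule infsum_reindex_bij_witness[of _ uminus uminus])
    show "\<sigma> * (c (- n) * g (t - of_int (- n))) = c n * g (- t - of_int n)" for n
      using assms(2)[of "t + of_int n"] by (simp add: assms(1) algebra_simps)
  qed auto
  thus ?thesis by (simp add: shift_series_def infsum_cmult_right')
qed

lemma shift_series_linear_combination:
  assumes "\<And>r n. r \<in> I \<Longrightarrow> norm (e r n) \<le> C"
  shows "shift_series (\<lambda>n. \<Sum>r\<in>I. d r * e r n) t = (\<Sum>r\<in>I. d r * shift_series (e r) t)"
proof -
  have "((\<lambda>n. \<Sum>r\<in>I. d r * (e r n * g (t - of_int n))) has_sum (\<Sum>r\<in>I. d r * shift_series (e r) t)) UNIV"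
    unfolding shift_series_def using assms
    by (intro has_sum_finite_sum has_sum_cmult_right has_sum_infsum shift_series_summable)
  thus ?thesis
    unfolding shift_series_def by (intro infsumI) (simp add: sum_distrib_right mult.assoc)
qed

lemma small_near_zeros:
  assumes "finite F" and c: "\<And>n. norm (c n) \<le> C" and zero: "\<And>l. l \<in> F \<Longrightarrow> shift_series c (- l) = 0" and "0 < \<eta>"
  obtains \<delta> where "0 < \<delta>" "\<delta> \<le> 1" "\<And>l x. l \<in> F \<Longrightarrow> x \<in> {0..<\<delta>} \<Longrightarrow> norm (shift_series c (x - l)) \<le> \<eta>"
proof -
  have "eventually (\<lambda>x. norm (shift_series c (x - l)) < \<eta>) (at 0 within {0..1})" if "l \<in> F" for l
  proof -
    have "continuous_on {0..1} (\<lambda>x. shift_series c (x - l))"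
      by (rule continuous_on_compose2[OF continuous_on_shift_series[OF c, of "- l"]])
         (auto intro!: continuous_intros)
    hence "((\<lambda>x. shift_series c (x - l)) \<longlongrightarrow> shift_series c (0 - l)) (at 0 within {0..1})"
      unfolding continuous_on_def by (rule bspec) simp
    hence "((\<lambda>x. norm (shift_series c (x - l))) \<longlongrightarrow> 0) (at 0 within {0..1})"
      using zero[OF that] by (simp add: tendsto_norm_zero)
    thus ?thesis using \<open>0 < \<eta>\<close> by (rule order_tendstoD)
  qed
  hence "eventually (\<lambda>x. \<forall>l\<in>F. norm (shift_series c (x - l)) < \<eta>) (at 0 within {0..1})"
    using \<open>finite F\<close> by (simp add: eventually_ball_finite)
  then obtain d where d: "d > 0"
    "\<And>x. x \<in> {0..1} \<Longrightarrow> x \<noteq> 0 \<Longrightarrow> dist x 0 < d \<Longrightarrow> \<forall>l\<in>F. norm (shift_series c (x - l)) < \<eta>"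
    unfolding eventually_at by blast
  show ?thesis
  proof (rule that[of "min d 1"])
    show "norm (shift_series c (x - l)) \<le> \<eta>" if "l \<in> F" "x \<in> {0..<min d 1}" for l x
      using that d(2)[of x] zero[of l] \<open>0 < \<eta>\<close> by (cases "x = 0") (auto simp: less_imp_le)
  qed (use d(1) in auto)
qed

text \<open>
  Points of one coset \<open>a + k\<int>\<close> have distinct integer parts, so a bound for sums over sets with that
  property gives a bound for the lattice at the cost of a factor \<open>card F\<close>.
\<close>

lemma lattice_sum_le:
  assumes k: "1 \<le> k" and F: "finite F" and L: "finite L" "L \<subseteq> F + multiples k"
    and bnd: "\<And>T. finite T \<Longrightarrow> inj_on floor T \<Longrightarrow> (\<And>t. t \<in> T \<Longrightarrow> norm (shift_series c t) \<le> \<eta>) \<Longrightarrow>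
       (\<Sum>t\<in>T. \<phi> t) \<le> R"
    and per: "\<And>t. norm (shift_series c (t + real k)) = norm (shift_series c t)"
    and small: "\<And>l. l \<in> F \<Longrightarrow> norm (shift_series c (x - l)) \<le> \<eta>"
  shows "(\<Sum>l\<in>L. \<phi> (x - l)) \<le> real (card F) * R"
proof -
  have "\<forall>l\<in>L. \<exists>a j. a \<in> F \<and> l = a + real k * of_int j"
    using L(2) unfolding set_plus_def multiples_def by fastforce
  then obtain rep m where rep: "\<And>l. l \<in> L \<Longrightarrow> rep l \<in> F" "\<And>l. l \<in> L \<Longrightarrow> l = rep l + real k * of_int (m l)"
    by metis
  have "(\<Sum>l\<in>L. \<phi> (x - l)) = (\<Sum>a\<in>F. \<Sum>l\<in>{l\<in>L. rep l = a}. \<phi> (x - l))"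
    using L(1) F rep(1) by (intro sum.group[symmetric]) auto
  also have "\<dots> \<le> (\<Sum>a\<in>F. R)"
  proof (rule sum_mono)
    fix a assume a: "a \<in> F"
    define T where "T = (\<lambda>l. x - l) ` {l\<in>L. rep l = a}"
    have T: "\<exists>j::int. t = x - a + of_int j * real k" if "t \<in> T" for t
    proof -
      from that obtain l where l: "l \<in> L" "rep l = a" "t = x - l" by (auto simp: T_def)
      hence "t = x - a + of_int (- m l) * real k" using rep(2)[OF l(1)] by (simp add: algebra_simps)
      thus ?thesis ..
    qed
    have "(\<Sum>t\<in>T. \<phi> t) \<le> R"
    proof (rule bnd)
      show "finite T" using L(1) by (simp add: T_def)
      show "inj_on floor T"
      proof (rule inj_onI)
        fix t t' assume tt: "t \<in> T" "t' \<in> T" "\<lfloor>t\<rfloor> = \<lfloor>t'\<rfloor>"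
        obtain j j' where j: "t = x - a + of_int j * real k" "t' = x - a + of_int j' * real k"
          using T tt by blast
        have "t = x - a + of_int (j * int k)" "t' = x - a + of_int (j' * int k)" by (simp_all add: j)
        hence "\<lfloor>t\<rfloor> = \<lfloor>x - a\<rfloor> + j * int k" "\<lfloor>t'\<rfloor> = \<lfloor>x - a\<rfloor> + j' * int k"
          by (simp_all only: floor_add_int)
        with tt(3) k have "j = j'" by simp
        thus "t = t'" by (simp add: j)
      qed
      show "norm (shift_series c t) \<le> \<eta>" if "t \<in> T" for t
        using T[OF that] small[OF a] periodic_of_int_mult[where f = "\<lambda>t. norm (shift_series c t)", OF per] by auto
    qed
    thus "(\<Sum>l\<in>{l\<in>L. rep l = a}. \<phi> (x - l)) \<le> R"
      unfolding T_def by (subst (asm) sum.reindex) (auto simp: inj_on_def)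
  qed
  finally show ?thesis by simp
qed

lemma small_tail:
  assumes "0 < \<epsilon>"
  obtains B K where "infsum \<gamma> (- B) \<le> \<epsilon>" "0 \<le> K" "\<And>m. m \<in> B \<Longrightarrow> \<bar>m\<bar> \<le> (K::int)"
proof -
  obtain B where B: "finite B" "dist (sum \<gamma> B) (infsum \<gamma> UNIV) \<le> \<epsilon>"
    using infsum_finite_approximation[OF \<gamma>_summable assms] by blast
  have "infsum \<gamma> (UNIV - B) = infsum \<gamma> UNIV - sum \<gamma> B"
    using B(1) by (subst infsum_Diff) (auto intro: \<gamma>_summable)
  hence "infsum \<gamma> (- B) \<le> \<epsilon>" using B(2) by (simp add: dist_real_def Compl_eq_Diff_UNIV)
  thus ?thesis
    by (rule that[of B "\<Sum>m\<in>B. \<bar>m\<bar>"]) (use B(1) in \<open>auto intro: sum_nonneg member_le_sum\<close>)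
qed

text \<open>
  Along the truncations of \<open>c\<close> to \<open>[-N, N]\<close> the coefficient side grows linearly in \<open>N\<close>, because \<open>\<bar>c\<bar>\<close> is
  \<open>k\<close>-periodic and not zero.  The sample side is at most \<open>const * \<epsilon> * N + const\<close>: the samples,
  taken near zeros of the series, are at most \<open>\<epsilon>\<close>, and the truncation error is \<open>o(N)\<close>.
\<close>

lemma not_frame_if_zeros:
  assumes k: "1 \<le> k" and F: "finite F" and c: "\<And>n. norm (c n) \<le> C" and "c n0 \<noteq> 0"
    and per: "\<And>n. c (n + int k) = s * c n" and s: "norm s = 1"
    and zero: "\<And>l. l \<in> F \<Longrightarrow> shift_series c (- l) = 0"
  shows "\<not> L2_frame ((F + multiples k) \<times> \<int>) (gabor g)"
proof
  assume "L2_frame ((F + multiples k) \<times> \<int>) (gabor g)"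
  then obtain A :: real where A: "A > 0"
    and low: "\<And>\<delta> N c R C. 0 < \<delta> \<Longrightarrow> \<delta> \<le> 1 \<Longrightarrow> (\<And>n. norm (c n) \<le> C) \<Longrightarrow>
      (\<And>x L. x \<in> {0..<\<delta>} \<Longrightarrow> finite L \<Longrightarrow> L \<subseteq> F + multiples k \<Longrightarrow> (\<Sum>l\<in>L. (norm (shift_series (trunc N c) (x - l)))\<^sup>2) \<le> R) \<Longrightarrow>
      A * (\<Sum>n\<in>{-N..N}. (norm (c n))\<^sup>2) \<le> R"
    using frame_coefficient_bound by blast
  define \<Gamma> where "\<Gamma> = infsum \<gamma> UNIV"
  define q where "q = (norm (c n0))\<^sup>2"
  define P where "P = real (card F) * (C * \<Gamma>)"
  have C: "0 \<le> C" using order_trans[OF norm_ge_zero c[of 0]] .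
  have \<Gamma>: "0 \<le> \<Gamma>" unfolding \<Gamma>_def by (intro infsum_nonneg \<gamma>_nonneg)
  have P: "0 \<le> P" unfolding P_def using C \<Gamma> by simp
  have q: "0 < q" unfolding q_def using \<open>c n0 \<noteq> 0\<close> by simp
  \<comment> \<open>The growth rate of the sample side per period is \<open>2 * k * P * (1 + 2 * C) * \<epsilon>\<close>; \<open>\<epsilon>\<close> makes it at most \<open>A * q / 2\<close>, also if \<open>P = 0\<close>.\<close>
  define X where "X = P * (1 + 2 * C) + 1"
  define \<epsilon> where "\<epsilon> = A * q / (4 * real k * X)"
  have X: "0 < X" unfolding X_def using P C by (simp add: add_nonneg_pos)
  have \<epsilon>: "0 < \<epsilon>" unfolding \<epsilon>_def using A q k X by simp
  have \<epsilon>_le: "2 * real k * (P * (1 + 2 * C)) * \<epsilon> \<le> A * q / 2"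
  proof -
    have "2 * real k * (P * (1 + 2 * C)) * \<epsilon> \<le> 2 * real k * X * \<epsilon>"
      using \<epsilon> by (intro mult_right_mono mult_left_mono) (auto simp: X_def)
    also have "\<dots> = A * q / 2" unfolding \<epsilon>_def using k X by (simp add: field_simps)
    finally show ?thesis .
  qed
  obtain \<delta> where \<delta>: "0 < \<delta>" "\<delta> \<le> 1" "\<And>l x. l \<in> F \<Longrightarrow> x \<in> {0..<\<delta>} \<Longrightarrow> norm (shift_series c (x - l)) \<le> \<epsilon>"
    using small_near_zeros[where c = c, OF F c zero \<epsilon>] by blast
  obtain B K where BK: "infsum \<gamma> (- B) \<le> \<epsilon>" "0 \<le> K" "\<And>m. m \<in> B \<Longrightarrow> \<bar>m\<bar> \<le> (K::int)"
    using small_tail[OF \<epsilon>] by blast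
  have per_shift_series: "norm (shift_series c (t + real k)) = norm (shift_series c t)" for t
    using shift_series_shift[where c = c, OF per, of t] s by (simp add: norm_mult)
  have per_c: "norm (c (n + j * int k)) = norm (c n)" for n j
    using periodic_of_int_mult[where f = "\<lambda>n. norm (c n)" and p = "int k" and t = n and j = j] per s
    by (simp add: norm_mult)
  have main: "real j * (A * q) \<le> real j * (A * q / 2) + D"
    if "D = P * (1 + 2 * C) * \<epsilon> * (2 * \<bar>real_of_int n0\<bar> + 1) + P * C * 2 * of_int K * \<Gamma>" for j :: nat and D
  proof -
    \<comment> \<open>This \<open>N\<close> leaves room for the \<open>j\<close> translates \<open>n0 + k, \<dots>, n0 + j * k\<close> of the index \<open>n0\<close>.\<close>
    define N where "N = int j * int k + \<bar>n0\<bar>"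
    have N: "0 \<le> N" by (simp add: N_def)
    have "real j * q = (\<Sum>i\<in>{1..int j}. (norm (c (n0 + i * int k)))\<^sup>2)"
      by (simp add: per_c q_def)
    also have "\<dots> = (\<Sum>n\<in>(\<lambda>i. n0 + i * int k) ` {1..int j}. (norm (c n))\<^sup>2)"
      using k by (subst sum.reindex) (auto simp: inj_on_def)
    also have "\<dots> \<le> (\<Sum>n\<in>{-N..N}. (norm (c n))\<^sup>2)"
    proof (intro sum_mono2)
      show "(\<lambda>i. n0 + i * int k) ` {1..int j} \<subseteq> {- N..N}"
      proof clarify
        fix i assume "i \<in> {1..int j}"
        hence "0 \<le> i * int k" "i * int k \<le> int j * int k" by (auto intro: mult_right_mono)
        thus "n0 + i * int k \<in> {- N..N}" unfolding N_def by (simp; linarith)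
      qed
    qed auto
    finally have "A * (real j * q) \<le> A * (\<Sum>n\<in>{-N..N}. (norm (c n))\<^sup>2)" using A by simp
    also have "\<dots> \<le> real (card F) * (C * \<Gamma> * ((2 * of_int N + 1) * \<epsilon>
      + C * (2 * of_int K * \<Gamma> + (4 * of_int N + 2) * infsum \<gamma> (- B))))"
    proof (rule low[OF \<delta>(1,2) c])
      fix x L assume x: "x \<in> {0..<\<delta>}" and L: "finite L" "L \<subseteq> F + multiples k"
      show "(\<Sum>l\<in>L. (norm (shift_series (trunc N c) (x - l)))\<^sup>2) \<le> real (card F) * (C * \<Gamma> * ((2 * of_int N + 1) * \<epsilon>
        + C * (2 * of_int K * \<Gamma> + (4 * of_int N + 2) * infsum \<gamma> (- B))))"
        unfolding \<Gamma>_def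
      proof (rule lattice_sum_le[OF k F L _ per_shift_series])
        show "norm (shift_series c (x - l)) \<le> \<epsilon>" if "l \<in> F" for l using \<delta>(3)[OF that x] .
        show "(\<Sum>t\<in>T. (norm (shift_series (trunc N c) t))\<^sup>2) \<le> C * infsum \<gamma> UNIV * ((2 * of_int N + 1) * \<epsilon>
          + C * (2 * of_int K * infsum \<gamma> UNIV + (4 * of_int N + 2) * infsum \<gamma> (- B)))"
          if "finite T" "inj_on floor T" "\<And>t. t \<in> T \<Longrightarrow> norm (shift_series c t) \<le> \<epsilon>" for T
          by (rule sum_norm_shift_series_trunc_le[where c = c, OF c that N BK(3) BK(2) less_imp_le[OF \<epsilon>]])
      qed
    qed
    also have "\<dots> \<le> real (card F) * (C * \<Gamma> * ((2 * of_int N + 1) * \<epsilon>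
      + C * (2 * of_int K * \<Gamma> + (4 * of_int N + 2) * \<epsilon>)))"
      using C \<Gamma> N BK(1) by (intro mult_left_mono add_left_mono mult_nonneg_nonneg) auto
    also have "\<dots> = P * (1 + 2 * C) * \<epsilon> * (2 * of_int N + 1) + P * C * 2 * of_int K * \<Gamma>"
      by (simp add: P_def algebra_simps)
    also have "\<dots> = real j * (2 * real k * (P * (1 + 2 * C)) * \<epsilon>) + D"
      unfolding that N_def by (simp add: algebra_simps)
    also have "\<dots> \<le> real j * (A * q / 2) + D"
      using \<epsilon>_le by (intro add_right_mono mult_left_mono) auto
    finally show ?thesis by (simp add: mult_ac)
  qed
  define D where "D = P * (1 + 2 * C) * \<epsilon> * (2 * \<bar>real_of_int n0\<bar> + 1) + P * C * 2 * of_int K * \<Gamma>"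
  obtain j :: nat where "D < real j * (A * q / 2)"
    using reals_Archimedean3[of "A * q / 2"] A q by auto
  with main[OF D_def, of j] show False by simp
qed

end


section \<open>Zeros forced by symmetry\<close>

text \<open>
  The even sequence with \<open>c (n + k) = s * c n\<close> generated by the value \<open>1\<close> at \<open>r\<close>: it has period \<open>2 * k\<close>, is
  \<open>1\<close> at \<open>\<plusminus>r\<close> and \<open>s\<close> at \<open>k \<plusminus> r\<close> modulo \<open>2 * k\<close>.  For \<open>2 * r = k\<close> these residues coincide,
  and the recursion holds only for \<open>s = 1\<close>.
\<close>

definition symmetric_basis :: "complex \<Rightarrow> int \<Rightarrow> int \<Rightarrow> int \<Rightarrow> complex" where
  "symmetric_basis s k r n = (if 2 * k dvd n - r \<or> 2 * k dvd n + r then 1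
     else if 2 * k dvd n + k - r \<or> 2 * k dvd n + k + r then s else 0)"

lemma norm_eq_1_if_square_eq_1:
  fixes s :: "'a::real_normed_div_algebra"
  assumes "s * s = 1"
  shows "norm s = 1"
proof -
  have "(norm s)\<^sup>2 = 1" using assms by (metis norm_mult norm_one power2_eq_square)
  thus ?thesis by (simp add: power2_eq_1_iff) (smt (verit) norm_ge_zero)
qed

lemma symmetric_basis_reflect: "symmetric_basis s k r (- n) = symmetric_basis s k r n"
proof -
  have "- n - r = - (n + r)" "- n + r = - (n - r)"
    "- n + k - r = - (n + k + r) + 2 * k" "- n + k + r = - (n + k - r) + 2 * k"
    by simp_all
  hence "2 * k dvd - n - r \<longleftrightarrow> 2 * k dvd n + r" "2 * k dvd - n + r \<longleftrightarrow> 2 * k dvd n - r"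
    "2 * k dvd - n + k - r \<longleftrightarrow> 2 * k dvd n + k + r" "2 * k dvd - n + k + r \<longleftrightarrow> 2 * k dvd n + k - r"
    by (simp_all only: dvd_add_triv_right_iff dvd_minus_iff)
  thus ?thesis by (auto simp: symmetric_basis_def)
qed

text \<open>
  An index congruent both to \<open>\<plusminus>r\<close> and to \<open>k \<plusminus> r\<close> modulo \<open>2 * k\<close> requires \<open>2 * r = k\<close>; then evenness of the
  sequence \<open>c\<close> gives
  \<open>c r = c (- r) = c (r - k)\<close>, which is consistent with the factor \<open>s\<close> only if \<open>s = 1\<close>.
\<close>

lemma symmetric_basis_shift:
  assumes "0 < k" "0 \<le> r" "2 * r \<le> k" "s * s = 1" "s = 1 \<or> 2 * r < k"
  shows "symmetric_basis s k r (n + k) = s * symmetric_basis s k r n"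
proof -
  have "n + k + k - r = (n - r) + 2 * k" "n + k + k + r = (n + r) + 2 * k" by simp_all
  hence *: "2 * k dvd n + k + k - r \<longleftrightarrow> 2 * k dvd n - r" "2 * k dvd n + k + k + r \<longleftrightarrow> 2 * k dvd n + r"
    by (simp_all only: dvd_add_triv_right_iff)
  have "s = 1" if "2 * k dvd n - r \<or> 2 * k dvd n + r" "2 * k dvd n + k - r \<or> 2 * k dvd n + k + r"
  proof (rule ccontr)
    assume "s \<noteq> 1"
    hence r: "2 * r < k" using assms by simp
    have nd: "\<not> 2 * k dvd d" if "0 < d" "d < 2 * k" for d
      using that zdvd_not_zless by blast
    have "2 * k dvd (n + k - r) - (n - r) \<or> 2 * k dvd (n + k + r) - (n - r)
        \<or> 2 * k dvd (n + k - r) - (n + r) \<or> 2 * k dvd (n + k + r) - (n + r)"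
      using that by (blast intro: dvd_diff)
    moreover have "(n + k - r) - (n - r) = k" "(n + k + r) - (n - r) = k + 2 * r"
      "(n + k - r) - (n + r) = k - 2 * r" "(n + k + r) - (n + r) = k" by simp_all
    ultimately have "2 * k dvd k \<or> 2 * k dvd k + 2 * r \<or> 2 * k dvd k - 2 * r" by metis
    thus False using nd[of k] nd[of "k + 2 * r"] nd[of "k - 2 * r"] r assms by auto
  qed
  thus ?thesis unfolding symmetric_basis_def * using assms(4) by auto
qed

lemma symmetric_basis_at_small:
  assumes "0 < k" "0 \<le> r" "0 \<le> r'" "2 * r \<le> k" "2 * r' \<le> k"
  shows "symmetric_basis s k r r' = of_bool (r = r')"
proof (cases "r = r'")
  case False
  have nd: "\<not> 2 * k dvd d" if "d \<noteq> 0" "\<bar>d\<bar> < 2 * k" for d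
    using that by (metis abs_of_nonneg dvd_abs_iff abs_ge_zero less_le_not_le zdvd_not_zless zero_less_abs_iff)
  show ?thesis
    using False nd[of "r' - r"] nd[of "r' + r"] nd[of "r' + k - r"] nd[of "r' + k + r"] assms
    by (auto simp: symmetric_basis_def)
qed (simp add: symmetric_basis_def)

context dominated_window
begin

text \<open>
  The \<open>m + 1\<close> basis sequences with index at most \<open>m\<close> are linearly independent, as seen from their values
  at \<open>0, \<dots>, m\<close>, and the \<open>m\<close> linear conditions cannot exclude all their combinations.
\<close>

lemma symmetric_sequence_with_zeros:
  assumes k: "1 \<le> k" and s: "s * s = 1" and m: "2 * m \<le> k" "s = 1 \<or> 2 * m < k"
  obtains c C n0 where "\<And>n. norm (c n) \<le> C" "c n0 \<noteq> 0" "\<And>n. c (- n) = c n"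
    "\<And>n. c (n + int k) = s * c n" "\<And>j. j \<in> {1..m} \<Longrightarrow> shift_series c (x j) = 0"
proof -
  define e where "e r = symmetric_basis s (int k) (int r)" for r :: nat
  have "norm s = 1"
    by (rule norm_eq_1_if_square_eq_1[OF s])
  hence e_le: "norm (e r n) \<le> 1" for r n by (simp add: e_def symmetric_basis_def)
  obtain d r0 where d: "r0 \<in> {0..m}" "d r0 \<noteq> 0" "\<And>j. j \<in> {1..m} \<Longrightarrow> (\<Sum>r\<in>{0..m}. d r * shift_series (e r) (x j)) = 0"
    using underdetermined_system[of "{1..m}" "{0..m}" "\<lambda>j r. shift_series (e r) (x j)"] by auto
  define c where "c n = (\<Sum>r\<in>{0..m}. d r * e r n)" for n
  show ?thesis
  proof (rule that[of c "\<Sum>r\<in>{0..m}. norm (d r)" "int r0"])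
    show "norm (c n) \<le> (\<Sum>r\<in>{0..m}. norm (d r))" for n
      unfolding c_def by (rule order_trans[OF norm_sum]) (auto simp: norm_mult intro!: sum_mono mult_left_le e_le)
    have "c (int r0) = (\<Sum>r\<in>{0..m}. d r * of_bool (r = r0))"
      unfolding c_def e_def using k m(1) d(1) by (intro sum.cong refl) (subst symmetric_basis_at_small; auto)
    also have "\<dots> = d r0" using d(1) by simp
    finally show "c (int r0) \<noteq> 0" using d(2) by simp
    show "c (- n) = c n" for n by (simp add: c_def e_def symmetric_basis_reflect)
    show "c (n + int k) = s * c n" for n
    proof -
      have "e r (n + int k) = s * e r n" if "r \<in> {0..m}" for r
        unfolding e_def using that k m s by (intro symmetric_basis_shift) auto
      thus ?thesis by (simp add: c_def sum_distrib_left mult_ac)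
    qed
    show "shift_series c (x j) = 0" if "j \<in> {1..m}" for j
      unfolding c_def using d(3)[OF that] shift_series_linear_combination[where I = "{0..m}" and e = e and C = 1] e_le by simp
  qed
qed

text \<open>
  \<open>E\<close> consists of fixed points of the symmetries \<open>t \<mapsto> - t\<close> and \<open>t \<mapsto> k - t\<close>, under which the series changes
  by the factors \<open>\<sigma>\<close> and \<open>s * \<sigma>\<close>.  Where this factor is \<open>-1\<close> the series vanishes at the fixed point, so
  that these zeros cost no equation.
\<close>

lemma not_frame_if_symmetric:
  assumes k: "1 \<le> k" and \<sigma>: "\<And>t. g (- t) = \<sigma> * g t" and s: "s * s = 1" and m: "2 * m \<le> k" "s = 1 \<or> 2 * m < k"
    and E: "finite E" "\<And>t. t \<in> E \<Longrightarrow> t = 0 \<and> \<sigma> = - 1 \<or> t = real k / 2 \<and> s * \<sigma> = - 1"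
  shows "\<not> L2_frame (((F_pts m x \<union> E) + multiples k) \<times> \<int>) (gabor g)"
proof -
  obtain c C n0 where c: "\<And>n. norm (c n) \<le> C" "c n0 \<noteq> 0" "\<And>n. c (- n) = c n"
    "\<And>n. c (n + int k) = s * c n" "\<And>j. j \<in> {1..m} \<Longrightarrow> shift_series c (x j) = 0"
    using symmetric_sequence_with_zeros[OF k s m] by blast
  have reflect: "shift_series c (- t) = \<sigma> * shift_series c t" for t by (rule shift_series_reflect[where c = c, OF c(3) \<sigma>])
  have "shift_series c (- l) = 0" if l: "l \<in> F_pts m x \<union> E" for l
  proof -
    consider j where "j \<in> {1..m}" "l = x j \<or> l = - x j" | "l = 0" "\<sigma> = - 1"
      | "l = real k / 2" "s * \<sigma> = - 1"
      using l E(2)[of l] by (auto simp: F_pts_def)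
    thus ?thesis
    proof cases
      case 1
      thus ?thesis using c(5) reflect[of "x j"] by auto
    next
      case 2
      thus ?thesis using reflect[of 0] by simp
    next
      case 3
      have "shift_series c (- l + of_int (int k)) = s * shift_series c (- l)" by (rule shift_series_shift[where c = c and p = "int k" and s = s, OF c(4)])
      moreover have "- l + of_int (int k) = l" using 3 by simp
      ultimately have "shift_series c l = s * (\<sigma> * shift_series c l)" using reflect[of l] by simp
      also have "\<dots> = - shift_series c l" using 3(2) by (simp flip: mult.assoc)
      finally have "shift_series c l = 0" by simp
      thus ?thesis using reflect[of l] by simp
    qed
  qed
  moreover have "norm s = 1"
    by (rule norm_eq_1_if_square_eq_1[OF s])
  moreover have "finite (F_pts m x \<union> E)" using E(1) by (simp add: F_pts_def)
  ultimately show ?thesis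
    using not_frame_if_zeros[where c = c and F = "F_pts m x \<union> E", OF k _ c(1,2,4)] by blast
qed

end

theorem corollary3p2:
  fixes g :: "real \<Rightarrow> complex" and k :: nat
  assumes "g \<in> W0" and "stable_integer_shifts g" and "k \<ge> 1"
  shows "((\<forall>x. g (- x) = - g x) \<longrightarrow>
            (\<forall>x. increasing_points (k div 2) x \<longrightarrow>
               \<not> L2_frame (((F_pts (k div 2) x \<union> {0, real k / 2}) + multiples k) \<times> \<int>) (gabor g)))
       \<and> ((\<forall>x. g (- x) = g x) \<longrightarrow>
            (odd k \<longrightarrow> (\<forall>x. increasing_points ((k - 1) div 2) x \<longrightarrow>
               \<not> L2_frame (((F_pts ((k - 1) div 2) x \<union> {real k / 2}) + multiples k) \<times> \<int>) (gabor g)))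
          \<and> (even k \<longrightarrow> (\<forall>x. increasing_points (k div 2) x \<longrightarrow>
               \<not> L2_frame ((F_pts (k div 2) x + multiples k) \<times> \<int>) (gabor g))))"
proof -
  obtain \<gamma> :: "int \<Rightarrow> real" where "\<And>t. norm (g t) \<le> \<gamma> \<lfloor>t\<rfloor>" "\<gamma> summable_on UNIV"
    using W0_envelope[OF assms(1)] by blast
  moreover have "continuous_on UNIV g" using assms(1) by (simp add: W0_def)
  ultimately interpret dominated_window g \<gamma> by unfold_locales
  show ?thesis
  proof (intro conjI impI allI)
    fix x assume "\<forall>x. g (- x) = - g x"
    thus "\<not> L2_frame (((F_pts (k div 2) x \<union> {0, real k / 2}) + multiples k) \<times> \<int>) (gabor g)"
      using assms(3) by (intro not_frame_if_symmetric[where \<sigma> = "- 1" and s = 1]) auto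
  next
    fix x assume "\<forall>x. g (- x) = g x" "odd k"
    moreover from \<open>odd k\<close> have "2 * ((k - 1) div 2) < k" by (elim oddE) simp
    ultimately show "\<not> L2_frame (((F_pts ((k - 1) div 2) x \<union> {real k / 2}) + multiples k) \<times> \<int>) (gabor g)"
      using assms(3) by (intro not_frame_if_symmetric[where \<sigma> = 1 and s = "- 1"]) auto
  next
    fix x assume "\<forall>x. g (- x) = g x"
    thus "\<not> L2_frame ((F_pts (k div 2) x + multiples k) \<times> \<int>) (gabor g)"
      using assms(3) not_frame_if_symmetric[where \<sigma> = 1 and s = 1 and m = "k div 2" and E = "{}"] by simp
  qed
qed

end
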